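(* Let $(M,g)$ be a K\"ahler manifold of complex dimension $m>2$, let $\tau:M\to\mathbb R$ be a nonconstant $C^\infty$ function, and let $b$ be a constant. If $\widehat g=g/\tau^2$, on $M\smallsetminus\tau^{-1}(0)$, is a Ricci soliton with soliton function $b\tau^{-1}$, i.e. $\widehat\nabla d(b\tau^{-1})+\widehat{\mathrm r}=e\,\widehat g$ for some constant $e$ (Hessian and Ricci tensor of $\widehat g$), then $\tau$ is a special K\"ahler-Ricci potential on $(M,g)$.
   Context: On a K\"ahler manifold $(M,J,g)$, a Killing potential is a $C^\infty$ function $\tau$ such that $J\nabla\tau$ is a Killing vector field. $M_\tau$ denotes the complement in $M$ of the critical set of $\tau$. A nonconstant Killing potential $\tau$ is a special K\"ahler-Ricci potential if, on $M_\tau$, all nonzero tangent vectors orthogonal to $\nabla\tau$ and $J\nabla\tau$ are eigenvectors of both the Hessian $\nabla d\tau$ and the Ricci tensor $\mathrm r$ of $g$. *)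

theory Defs
  imports "HOL-Analysis.Analysis"
begin

section \<open>Calculus on open subsets of a Euclidean space\<close>

text \<open>The directional derivative of \<open>f\<close> at \<open>x\<close> along \<open>v\<close>.\<close>

abbreviation dirder :: "('e::euclidean_space \<Rightarrow> 'b::real_normed_vector) \<Rightarrow> 'e \<Rightarrow> 'e \<Rightarrow> 'b" where
  "dirder f x v \<equiv> frechet_derivative f (at x) v"

text \<open>Both notions below are meant for open sets \<open>S\<close>.\<close>

primrec Ck_on :: "nat \<Rightarrow> 'e set \<Rightarrow> ('e::euclidean_space \<Rightarrow> 'b::real_normed_vector) \<Rightarrow> bool" where
  "Ck_on 0 S f \<longleftrightarrow> continuous_on S f"
| "Ck_on (Suc k) S f \<longleftrightarrow>
     (\<forall>x\<in>S. f differentiable (at x)) \<and> (\<forall>v. Ck_on k S (\<lambda>x. dirder f x v))"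

definition smooth_on :: "'e set \<Rightarrow> ('e::euclidean_space \<Rightarrow> 'b::real_normed_vector) \<Rightarrow> bool" where
  "smooth_on S f \<longleftrightarrow> (\<forall>k. Ck_on k S f)"


section \<open>Riemannian geometry of a metric given in one coordinate system\<close>

text \<open>Here \<open>G x u v\<close> is the value of a metric at the point \<open>x\<close> on the vectors \<open>u\<close>, \<open>v\<close>, whose
  components are taken with respect to the coordinate frame. All operators only depend on the
  germ of \<open>G\<close> at \<open>x\<close>.\<close>

definition grad :: "('e \<Rightarrow> 'e \<Rightarrow> 'e \<Rightarrow> real) \<Rightarrow> ('e::euclidean_space \<Rightarrow> real) \<Rightarrow> 'e \<Rightarrow> 'e" where
  "grad G f x = (THE w. \<forall>v. G x w v = dirder f x v)"

text \<open>The Christoffel symbols of the Levi-Civita connection, so that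
  \<open>\<nabla>\<^sub>u v = \<partial>\<^sub>u v + christoffel G x u v\<close>. With basis vectors for \<open>u\<close>, \<open>v\<close>, \<open>z\<close>
  the characterisation reads \<open>2 \<Gamma>\<^sub>i\<^sub>j\<^sub>k = \<partial>\<^sub>i g\<^sub>j\<^sub>k + \<partial>\<^sub>j g\<^sub>i\<^sub>k - \<partial>\<^sub>k g\<^sub>i\<^sub>j\<close>.\<close>

definition christoffel ::
    "('e \<Rightarrow> 'e \<Rightarrow> 'e \<Rightarrow> real) \<Rightarrow> 'e::euclidean_space \<Rightarrow> 'e \<Rightarrow> 'e \<Rightarrow> 'e" where
  "christoffel G x u v = (THE w. \<forall>z.
     2 * G x w z = dirder (\<lambda>y. G y v z) x u + dirder (\<lambda>y. G y u z) x v - dirder (\<lambda>y. G y u v) x z)"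

text \<open>The Hessian \<open>\<nabla>df\<close>.\<close>

definition hessian ::
    "('e \<Rightarrow> 'e \<Rightarrow> 'e \<Rightarrow> real) \<Rightarrow> ('e::euclidean_space \<Rightarrow> real) \<Rightarrow> 'e \<Rightarrow> 'e \<Rightarrow> 'e \<Rightarrow> real" where
  "hessian G f x u v =
     dirder (\<lambda>y. dirder f y v) x u - dirder f x (christoffel G x u v)"

text \<open>\<open>R(u,v)w = \<nabla>\<^sub>u\<nabla>\<^sub>v w - \<nabla>\<^sub>v\<nabla>\<^sub>u w - \<nabla>\<^bsub>[u,v]\<^esub> w\<close>, and the Ricci tensor is
  \<open>r(v,w) = trace (u \<mapsto> R(u,v)w)\<close>, which is positive for round spheres.\<close>

definition curvature ::
    "('e \<Rightarrow> 'e \<Rightarrow> 'e \<Rightarrow> real) \<Rightarrow> 'e::euclidean_space \<Rightarrow> 'e \<Rightarrow> 'e \<Rightarrow> 'e \<Rightarrow> 'e" where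
  "curvature G x u v w =
     dirder (\<lambda>y. christoffel G y v w) x u - dirder (\<lambda>y. christoffel G y u w) x v
     + christoffel G x u (christoffel G x v w) - christoffel G x v (christoffel G x u w)"

definition ricci ::
    "('e \<Rightarrow> 'e \<Rightarrow> 'e \<Rightarrow> real) \<Rightarrow> 'e::euclidean_space \<Rightarrow> 'e \<Rightarrow> 'e \<Rightarrow> real" where
  "ricci G x v w = (\<Sum>i\<in>Basis. curvature G x i v w \<bullet> i)"

text \<open>The covariant derivative \<open>(\<nabla>\<^sub>u J)v\<close> of a field of endomorphisms.\<close>

definition covder_endo ::
    "('e \<Rightarrow> 'e \<Rightarrow> 'e \<Rightarrow> real) \<Rightarrow> ('e \<Rightarrow> 'e \<Rightarrow> 'e) \<Rightarrow> 'e::euclidean_space \<Rightarrow> 'e \<Rightarrow> 'e \<Rightarrow> 'e" where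
  "covder_endo G J x u v =
     dirder (\<lambda>y. J y v) x u + christoffel G x u (J x v) - J x (christoffel G x u v)"

text \<open>The Lie derivative \<open>(L\<^sub>X g)(u,v)\<close>.\<close>

definition lie_metric ::
    "('e \<Rightarrow> 'e) \<Rightarrow> ('e \<Rightarrow> 'e \<Rightarrow> 'e \<Rightarrow> real) \<Rightarrow> 'e::euclidean_space \<Rightarrow> 'e \<Rightarrow> 'e \<Rightarrow> real" where
  "lie_metric X G x u v =
     dirder (\<lambda>y. G y u v) x (X x) + G x (dirder X x u) v + G x u (dirder X x v)"

text \<open>Eigenvectors of a symmetric bilinear form \<open>B\<close> relative to the inner product \<open>H\<close>.\<close>

definition eigenvector :: "('e \<Rightarrow> 'e \<Rightarrow> real) \<Rightarrow> ('e \<Rightarrow> 'e \<Rightarrow> real) \<Rightarrow> 'e::zero \<Rightarrow> bool" where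
  "eigenvector H B v \<longleftrightarrow> v \<noteq> 0 \<and> (\<exists>l. \<forall>w. B v w = l * H v w)"


section \<open>Manifolds and tensor fields\<close>

text \<open>The manifold is the whole type \<open>'m\<close>. A chart is a pair of a domain and a coordinate map,
  whose values outside the domain are irrelevant.\<close>

type_synonym ('m, 'e) chart = "'m set \<times> ('m \<Rightarrow> 'e)"

abbreviation cdom :: "('m, 'e) chart \<Rightarrow> 'm set" where "cdom c \<equiv> fst c"
abbreviation cmap :: "('m, 'e) chart \<Rightarrow> 'm \<Rightarrow> 'e" where "cmap c \<equiv> snd c"
abbreviation cinv :: "('m, 'e) chart \<Rightarrow> 'e \<Rightarrow> 'm" where "cinv c \<equiv> inv_into (cdom c) (cmap c)"

definition transition :: "('m, 'e) chart \<Rightarrow> ('m, 'e) chart \<Rightarrow> 'e \<Rightarrow> 'e" where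
  "transition c d = cmap d \<circ> cinv c"

definition smooth_manifold ::
    "('m::{t2_space,second_countable_topology}, 'e::euclidean_space) chart set \<Rightarrow> bool" where
  "smooth_manifold A \<longleftrightarrow>
     (\<Union>c\<in>A. cdom c) = UNIV \<and>
     (\<forall>c\<in>A. open (cdom c) \<and> open (cmap c ` cdom c) \<and>
        homeomorphism (cdom c) (cmap c ` cdom c) (cmap c) (cinv c)) \<and>
     (\<forall>c\<in>A. \<forall>d\<in>A. smooth_on (cmap c ` (cdom c \<inter> cdom d)) (transition c d))"

text \<open>A tensor field is the family of its coordinate representations, one for each chart, subject
  to the usual transformation law. Fields on an open subset \<open>W\<close> of the manifold are only
  constrained on \<open>W\<close>.\<close>

type_synonym ('m, 'e) vfield = "('m, 'e) chart \<Rightarrow> 'e \<Rightarrow> 'e"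
type_synonym ('m, 'e) endo_field = "('m, 'e) chart \<Rightarrow> 'e \<Rightarrow> 'e \<Rightarrow> 'e"
type_synonym ('m, 'e) bilin_field = "('m, 'e) chart \<Rightarrow> 'e \<Rightarrow> 'e \<Rightarrow> 'e \<Rightarrow> real"

definition smooth_fun ::
    "('m, 'e::euclidean_space) chart set \<Rightarrow> 'm set \<Rightarrow> ('m \<Rightarrow> real) \<Rightarrow> bool" where
  "smooth_fun A W f \<longleftrightarrow> (\<forall>c\<in>A. smooth_on (cmap c ` (cdom c \<inter> W)) (f \<circ> cinv c))"

definition vector_field ::
    "('m, 'e::euclidean_space) chart set \<Rightarrow> 'm set \<Rightarrow> ('m, 'e) vfield \<Rightarrow> bool" where
  "vector_field A W X \<longleftrightarrow>
     (\<forall>c\<in>A. smooth_on (cmap c ` (cdom c \<inter> W)) (X c)) \<and>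
     (\<forall>c\<in>A. \<forall>d\<in>A. \<forall>x \<in> cmap c ` (cdom c \<inter> cdom d \<inter> W).
        dirder (transition c d) x (X c x) = X d (transition c d x))"

definition endomorphism_field ::
    "('m, 'e::euclidean_space) chart set \<Rightarrow> 'm set \<Rightarrow> ('m, 'e) endo_field \<Rightarrow> bool" where
  "endomorphism_field A W J \<longleftrightarrow>
     (\<forall>c\<in>A. (\<forall>x \<in> cmap c ` (cdom c \<inter> W). linear (J c x)) \<and>
        (\<forall>v. smooth_on (cmap c ` (cdom c \<inter> W)) (\<lambda>x. J c x v))) \<and>
     (\<forall>c\<in>A. \<forall>d\<in>A. \<forall>x \<in> cmap c ` (cdom c \<inter> cdom d \<inter> W). \<forall>v.
        dirder (transition c d) x (J c x v)
          = J d (transition c d x) (dirder (transition c d) x v))"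

definition bilinear_field ::
    "('m, 'e::euclidean_space) chart set \<Rightarrow> 'm set \<Rightarrow> ('m, 'e) bilin_field \<Rightarrow> bool" where
  "bilinear_field A W g \<longleftrightarrow>
     (\<forall>c\<in>A. (\<forall>x \<in> cmap c ` (cdom c \<inter> W). bilinear (g c x)) \<and>
        (\<forall>u v. smooth_on (cmap c ` (cdom c \<inter> W)) (\<lambda>x. g c x u v))) \<and>
     (\<forall>c\<in>A. \<forall>d\<in>A. \<forall>x \<in> cmap c ` (cdom c \<inter> cdom d \<inter> W). \<forall>u v.
        g c x u v = g d (transition c d x)
          (dirder (transition c d) x u) (dirder (transition c d) x v))"

definition riemannian_metric ::
    "('m, 'e::euclidean_space) chart set \<Rightarrow> 'm set \<Rightarrow> ('m, 'e) bilin_field \<Rightarrow> bool" where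
  "riemannian_metric A W g \<longleftrightarrow>
     bilinear_field A W g \<and>
     (\<forall>c\<in>A. \<forall>x \<in> cmap c ` (cdom c \<inter> W).
        (\<forall>u v. g c x u v = g c x v u) \<and> (\<forall>v. v \<noteq> 0 \<longrightarrow> g c x v v > 0))"

text \<open>The conformally related metric \<open>g/\<tau>\<^sup>2\<close>; a metric only where \<open>\<tau> \<noteq> 0\<close>.\<close>

definition conformal_metric ::
    "('m, 'e) bilin_field \<Rightarrow> ('m \<Rightarrow> real) \<Rightarrow> ('m, 'e) bilin_field" where
  "conformal_metric g \<tau> = (\<lambda>c x u v. g c x u v / (\<tau> (cinv c x))\<^sup>2)"

definition ricci_soliton ::
    "('m, 'e::euclidean_space) chart set \<Rightarrow> 'm set \<Rightarrow> ('m, 'e) bilin_field \<Rightarrow> ('m \<Rightarrow> real) \<Rightarrow> bool"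
  where
  "ricci_soliton A W g f \<longleftrightarrow>
     riemannian_metric A W g \<and> smooth_fun A W f \<and>
     (\<exists>e::real. \<forall>c\<in>A. \<forall>x \<in> cmap c ` (cdom c \<inter> W). \<forall>u v.
        hessian (g c) (f \<circ> cinv c) x u v + ricci (g c) x u v = e * g c x u v)"


section \<open>Kaehler manifolds and special Kaehler-Ricci potentials\<close>

text \<open>A Kaehler manifold is a Riemannian manifold with a compatible almost complex structure that
  is parallel for the Levi-Civita connection. Its complex dimension is \<open>DIM('e) / 2\<close>.\<close>

definition kaehler_manifold ::
    "('m::{t2_space,second_countable_topology}, 'e::euclidean_space) chart set
      \<Rightarrow> ('m, 'e) endo_field \<Rightarrow> ('m, 'e) bilin_field \<Rightarrow> bool" where
  "kaehler_manifold A J g \<longleftrightarrow>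
     smooth_manifold A \<and> riemannian_metric A UNIV g \<and> endomorphism_field A UNIV J \<and>
     (\<forall>c\<in>A. \<forall>x \<in> cmap c ` cdom c.
        (\<forall>v. J c x (J c x v) = - v) \<and>
        (\<forall>u v. g c x (J c x u) (J c x v) = g c x u v) \<and>
        (\<forall>u v. covder_endo (g c) (J c) x u v = 0))"

definition killing_field ::
    "('m, 'e::euclidean_space) chart set \<Rightarrow> ('m, 'e) bilin_field \<Rightarrow> ('m, 'e) vfield \<Rightarrow> bool" where
  "killing_field A g X \<longleftrightarrow>
     vector_field A UNIV X \<and>
     (\<forall>c\<in>A. \<forall>x \<in> cmap c ` cdom c. \<forall>u v. lie_metric (X c) (g c) x u v = 0)"

definition gradient :: "('m, 'e::euclidean_space) bilin_field \<Rightarrow> ('m \<Rightarrow> real) \<Rightarrow> ('m, 'e) vfield" where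
  "gradient g f = (\<lambda>c x. grad (g c) (f \<circ> cinv c) x)"

definition killing_potential ::
    "('m, 'e::euclidean_space) chart set \<Rightarrow> ('m, 'e) endo_field \<Rightarrow> ('m, 'e) bilin_field
      \<Rightarrow> ('m \<Rightarrow> real) \<Rightarrow> bool" where
  "killing_potential A J g \<tau> \<longleftrightarrow>
     smooth_fun A UNIV \<tau> \<and> killing_field A g (\<lambda>c x. J c x (gradient g \<tau> c x))"

definition critical_set ::
    "('m, 'e::euclidean_space) chart set \<Rightarrow> ('m \<Rightarrow> real) \<Rightarrow> 'm set" where
  "critical_set A f = {p. \<forall>c\<in>A. p \<in> cdom c \<longrightarrow> (\<forall>v. dirder (f \<circ> cinv c) (cmap c p) v = 0)}"

definition special_kaehler_ricci_potential ::
    "('m, 'e::euclidean_space) chart set \<Rightarrow> ('m, 'e) endo_field \<Rightarrow> ('m, 'e) bilin_field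
      \<Rightarrow> ('m \<Rightarrow> real) \<Rightarrow> bool" where
  "special_kaehler_ricci_potential A J g \<tau> \<longleftrightarrow>
     killing_potential A J g \<tau> \<and> (\<exists>p q. \<tau> p \<noteq> \<tau> q) \<and>
     (\<forall>c\<in>A. \<forall>x \<in> cmap c ` (cdom c - critical_set A \<tau>). \<forall>v.
        v \<noteq> 0 \<and> g c x v (gradient g \<tau> c x) = 0 \<and> g c x v (J c x (gradient g \<tau> c x)) = 0 \<longrightarrow>
        eigenvector (g c x) (hessian (g c) (\<tau> \<circ> cinv c) x) v \<and>
        eigenvector (g c x) (ricci (g c) x) v)"

end

theory Submission
  imports Defs
begin

text \<open>
  Write \<open>n\<close> for the real dimension. The Ricci tensor of \<open>g / \<tau>\<^sup>2\<close> differs from the Ricci tensor \<open>r\<close> of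
  \<open>g\<close> by a combination of \<open>\<nabla>d\<tau>\<close> and \<open>g\<close>, and the Hessian of \<open>b / \<tau>\<close> with respect to \<open>g / \<tau>\<^sup>2\<close> is such
  a combination too: its terms in \<open>d\<tau> \<otimes> d\<tau>\<close> cancel. Where \<open>\<tau> \<noteq> 0\<close> the
  soliton equation therefore reads \<open>r + \<chi> \<nabla>d\<tau> = \<sigma> g\<close> with \<open>\<chi> = (n - 2) / \<tau> - b / \<tau>\<^sup>2\<close> and some
  function \<open>\<sigma>\<close> (lemma \<open>soliton_equation\<close>).

  Since \<open>r\<close> and \<open>g\<close> are invariant under \<open>J\<close>, so is \<open>\<nabla>d\<tau>\<close> wherever \<open>\<chi> \<noteq> 0\<close>. The exceptional values of
  \<open>\<tau>\<close> are finitely many, and on an open set where \<open>\<tau>\<close> takes only such values it is locally constant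
  and its Hessian vanishes; by continuity \<open>\<nabla>d\<tau>\<close> is \<open>J\<close>-invariant everywhere, which says that \<open>J\<nabla>\<tau>\<close> is
  a Killing field.

  Composing with \<open>J\<close> turns the three tensors into 2-forms \<open>\<rho> + \<chi> \<alpha> = \<sigma> \<omega>\<close>, and all of \<open>\<rho>\<close>, \<open>\<alpha>\<close>, \<open>\<omega>\<close>
  are closed: for \<open>\<rho>\<close> this is the traced second Bianchi identity, while \<open>\<alpha>\<close> is up to a factor the
  differential of the 1-form \<open>d\<tau> \<circ> J\<close>. Hence \<open>d\<chi> \<and> \<alpha> = d\<sigma> \<and> \<omega>\<close> with \<open>d\<chi>\<close> proportional to \<open>d\<tau>\<close>
  (lemma \<open>differentiated_equation\<close>). In real dimension at least 6 there is room for a vector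
  orthogonal to any four given ones, and inserting it shows that \<open>d\<sigma>\<close> vanishes on the kernel of \<open>d\<tau>\<close>.
  Inserting \<open>\<nabla>\<tau>\<close> next shows that \<open>\<alpha>\<close> is a multiple of \<open>\<omega>\<close> there, so every vector orthogonal to
  \<open>\<nabla>\<tau>\<close> and \<open>J\<nabla>\<tau>\<close> is an eigenvector of \<open>\<nabla>d\<tau>\<close>, and then of \<open>r\<close>. This needs \<open>\<chi>' \<noteq> 0\<close>, which again
  excludes finitely many values of \<open>\<tau>\<close>, and a second density argument reaches every point with
  \<open>d\<tau> \<noteq> 0\<close>.

  Everything except the transformation behaviour of \<open>J\<nabla>\<tau>\<close> and the meaning of the critical set is
  local, and is carried out in one chart with explicit Christoffel symbols.
\<close>

section \<open>Calculus on open sets\<close>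

lemma dirder_has_derivative:
  "f differentiable (at x) \<Longrightarrow> (f has_derivative dirder f x) (at x)"
  using frechet_derivative_works by blast

lemma dirder_eqI: "(f has_derivative f') (at x) \<Longrightarrow> dirder f x v = f' v"
  using frechet_derivative_at[of f f' x] by simp

lemma linear_dirder: "f differentiable (at x) \<Longrightarrow> linear (dirder f x)"
  using dirder_has_derivative has_derivative_linear by blast

lemma dirder_cong:
  assumes "open S" "x \<in> S" "\<And>y. y \<in> S \<Longrightarrow> f y = h y"
  shows "dirder f x = dirder h x"
proof -
  have "(f has_derivative D) (at x) \<longleftrightarrow> (h has_derivative D) (at x)" for D
    using has_derivative_transform_within_open[of f D x UNIV S h]
      has_derivative_transform_within_open[of h D x UNIV S f] assms by auto
  then show ?thesis unfolding frechet_derivative_def by simp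
qed

lemma differentiable_cong:
  assumes "open S" "x \<in> S" "\<And>y. y \<in> S \<Longrightarrow> f y = h y"
  shows "f differentiable (at x) \<longleftrightarrow> h differentiable (at x)"
proof -
  have "(f has_derivative D) (at x) \<longleftrightarrow> (h has_derivative D) (at x)" for D
    using has_derivative_transform_within_open[of f D x UNIV S h]
      has_derivative_transform_within_open[of h D x UNIV S f] assms by auto
  then show ?thesis unfolding differentiable_def by simp
qed

lemma linear_basis_expansion:
  assumes "linear f"
  shows "f w = (\<Sum>i\<in>Basis. (w \<bullet> i) *\<^sub>R f i)"
proof -
  have "f w = f (\<Sum>i\<in>Basis. (w \<bullet> i) *\<^sub>R i)" by (simp only: euclidean_representation)
  also have "\<dots> = (\<Sum>i\<in>Basis. (w \<bullet> i) *\<^sub>R f i)"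
    by (simp only: linear_sum[OF assms] linear_scale[OF assms])
  finally show ?thesis .
qed

lemma Ck_on_cong:
  assumes "open S" "\<And>y. y \<in> S \<Longrightarrow> f y = h y"
  shows "Ck_on k S f \<longleftrightarrow> Ck_on k S h"
  using assms(2)
proof (induction k arbitrary: f h)
  case 0
  then show ?case by (simp cong: continuous_on_cong)
next
  case (Suc k)
  have "Ck_on k S (\<lambda>x. dirder f x v) \<longleftrightarrow> Ck_on k S (\<lambda>x. dirder h x v)" for v
    using dirder_cong[OF assms(1) _ Suc.prems] by (intro Suc.IH) auto
  then show ?case
    using differentiable_cong[OF assms(1) _ Suc.prems] by simp
qed

lemma Ck_on_Suc_imp: "Ck_on (Suc k) S f \<Longrightarrow> Ck_on k S f"
proof (induction k arbitrary: f)
  case 0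
  then show ?case
    by (auto intro!: continuous_at_imp_continuous_on differentiable_imp_continuous_within)
next
  case (Suc k)
  have "\<forall>x\<in>S. f differentiable (at x)" "Ck_on (Suc k) S (\<lambda>x. dirder f x v)" for v
    using Suc.prems Ck_on.simps(2)[of "Suc k" S f] by blast+
  then show ?case
    using Suc.IH by (simp only: Ck_on.simps(2)[of k]) simp
qed

lemma Ck_on_const: "Ck_on k S (\<lambda>x. c)"
  by (induction k arbitrary: c) simp_all

lemma Ck_on_add:
  assumes "open S" "Ck_on k S f" "Ck_on k S h"
  shows "Ck_on k S (\<lambda>x. f x + h x)"
  using assms(2,3)
proof (induction k arbitrary: f h)
  case 0
  then show ?case by (simp add: continuous_on_add)
next
  case (Suc k)
  have eq: "dirder (\<lambda>x. f x + h x) x v = dirder f x v + dirder h x v" if "x \<in> S" for x v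
    using Suc.prems that
    by (intro dirder_eqI[OF has_derivative_add]) (auto intro: dirder_has_derivative)
  have "Ck_on k S (\<lambda>x. dirder (\<lambda>x. f x + h x) x v)" for v
    using Suc by (subst Ck_on_cong[OF assms(1) eq]) auto
  then show ?case using Suc.prems by auto
qed

text \<open>The induction is on the order: a derivative of the product is a sum of two products whose
  factors are of the next lower class.\<close>

lemma Ck_on_scaleR:
  fixes f :: "'e::euclidean_space \<Rightarrow> real"
  assumes "open S" "Ck_on k S f" "Ck_on k S h"
  shows "Ck_on k S (\<lambda>x. f x *\<^sub>R h x)"
  using assms(2,3)
proof (induction k arbitrary: f h)
  case 0
  then show ?case by (simp add: continuous_on_scaleR)
next
  case (Suc k)
  have der: "((\<lambda>x. f x *\<^sub>R h x) has_derivative (\<lambda>v. f x *\<^sub>R dirder h x v + dirder f x v *\<^sub>R h x)) (at x)"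
    if "x \<in> S" for x
    using Suc.prems that
    by (intro has_derivative_scaleR) (auto intro: dirder_has_derivative)
  have eq: "dirder (\<lambda>x. f x *\<^sub>R h x) x v = f x *\<^sub>R dirder h x v + dirder f x v *\<^sub>R h x" if "x \<in> S" for x v
    using dirder_eqI[OF der[OF that]] .
  have "Ck_on k S f" "Ck_on k S h" using Suc.prems Ck_on_Suc_imp by blast+
  then have "Ck_on k S (\<lambda>x. dirder (\<lambda>x. f x *\<^sub>R h x) x v)" for v
    using Suc.prems by (subst Ck_on_cong[OF assms(1) eq]) (auto intro!: Ck_on_add[OF assms(1)] Suc.IH)
  then show ?case using der by (auto simp: differentiable_def)
qed

lemma Ck_on_bounded_linear:
  assumes "open S" "bounded_linear L" "Ck_on k S f"
  shows "Ck_on k S (\<lambda>x. L (f x))"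
  using assms(3)
proof (induction k arbitrary: f)
  case 0
  then show ?case using bounded_linear.continuous_on[OF assms(2)] by simp
next
  case (Suc k)
  have der: "((\<lambda>x. L (f x)) has_derivative (\<lambda>v. L (dirder f x v))) (at x)" if "x \<in> S" for x
    using Suc.prems that
    by (intro bounded_linear.has_derivative[OF assms(2)]) (auto intro: dirder_has_derivative)
  have eq: "dirder (\<lambda>x. L (f x)) x v = L (dirder f x v)" if "x \<in> S" for x v
    using dirder_eqI[OF der[OF that]] .
  have "Ck_on k S (\<lambda>x. dirder (\<lambda>x. L (f x)) x v)" for v
    using Suc by (subst Ck_on_cong[OF assms(1) eq]) auto
  then show ?case using der by (auto simp: differentiable_def)
qed

lemma Ck_on_sum:
  assumes "open S" "\<And>i. i \<in> I \<Longrightarrow> Ck_on k S (f i)"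
  shows "Ck_on k S (\<lambda>x. \<Sum>i\<in>I. f i x)"
  using assms(2)
  by (induction I rule: infinite_finite_induct) (auto simp: Ck_on_const intro: Ck_on_add[OF assms(1)])

lemma Ck_on_linear_family:
  fixes F :: "'e::euclidean_space \<Rightarrow> 'a::euclidean_space \<Rightarrow> 'b::real_normed_vector"
  assumes "open S" "\<And>x. x \<in> S \<Longrightarrow> linear (F x)"
    and "\<And>i. Ck_on k S (\<lambda>x. F x i)" "Ck_on k S X"
  shows "Ck_on k S (\<lambda>x. F x (X x))"
proof -
  have eq: "F x (X x) = (\<Sum>i\<in>Basis. (X x \<bullet> i) *\<^sub>R F x i)" if "x \<in> S" for x
    by (rule linear_basis_expansion[OF assms(2)[OF that]])
  show ?thesis
    using assms
    by (subst Ck_on_cong[OF assms(1) eq])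
      (auto intro!: Ck_on_sum Ck_on_scaleR Ck_on_bounded_linear[OF _ bounded_linear_inner_left])
qed

lemma smooth_on_dirder: "smooth_on S f \<Longrightarrow> smooth_on S (\<lambda>x. dirder f x v)"
  unfolding smooth_on_def using Ck_on.simps(2) by blast

lemma smooth_on_differentiable: "smooth_on S f \<Longrightarrow> x \<in> S \<Longrightarrow> f differentiable (at x)"
  unfolding smooth_on_def using Ck_on.simps(2)[of 0 S f] by blast

lemma smooth_on_continuous: "smooth_on S f \<Longrightarrow> continuous_on S f"
  unfolding smooth_on_def using Ck_on.simps(1)[of S f] by blast

lemma has_derivative_linear_family:
  fixes F :: "'e::euclidean_space \<Rightarrow> 'a::euclidean_space \<Rightarrow> 'b::real_normed_vector"
  assumes "open S" "x \<in> S" and lin: "\<And>y. y \<in> S \<Longrightarrow> linear (F y)"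
    and dF: "\<And>i. (\<lambda>y. F y i) differentiable (at x)" and dX: "X differentiable (at x)"
  shows "((\<lambda>y. F y (X y)) has_derivative
           (\<lambda>h. dirder (\<lambda>y. F y (X x)) x h + F x (dirder X x h))) (at x)"
proof -
  have rep: "F y w = (\<Sum>i\<in>Basis. (w \<bullet> i) *\<^sub>R F y i)" if "y \<in> S" for y w
    by (rule linear_basis_expansion[OF lin[OF that]])
  have 1: "((\<lambda>y. \<Sum>i\<in>Basis. (X y \<bullet> i) *\<^sub>R F y i) has_derivative
      (\<lambda>h. \<Sum>i\<in>Basis. (X x \<bullet> i) *\<^sub>R dirder (\<lambda>y. F y i) x h + (dirder X x h \<bullet> i) *\<^sub>R F x i)) (at x)"
    by (intro has_derivative_sum has_derivative_scaleR has_derivative_inner_left dirder_has_derivative dF dX)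
  have 2: "((\<lambda>y. \<Sum>i\<in>Basis. (X x \<bullet> i) *\<^sub>R F y i) has_derivative
      (\<lambda>h. \<Sum>i\<in>Basis. (X x \<bullet> i) *\<^sub>R dirder (\<lambda>y. F y i) x h)) (at x)"
    by (intro has_derivative_sum has_derivative_scaleR_right dirder_has_derivative dF)
  have "dirder (\<lambda>y. F y (X x)) x h = (\<Sum>i\<in>Basis. (X x \<bullet> i) *\<^sub>R dirder (\<lambda>y. F y i) x h)" for h
    by (subst dirder_cong[OF assms(1,2) rep]) (auto intro: dirder_eqI[OF 2])
  then have "(\<lambda>h. \<Sum>i\<in>Basis. (X x \<bullet> i) *\<^sub>R dirder (\<lambda>y. F y i) x h + (dirder X x h \<bullet> i) *\<^sub>R F x i)
     = (\<lambda>h. dirder (\<lambda>y. F y (X x)) x h + F x (dirder X x h))"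
    by (subst rep[OF assms(2)]) (simp add: sum.distrib)
  with 1 have "((\<lambda>y. \<Sum>i\<in>Basis. (X y \<bullet> i) *\<^sub>R F y i) has_derivative
           (\<lambda>h. dirder (\<lambda>y. F y (X x)) x h + F x (dirder X x h))) (at x)"
    by simp
  then show ?thesis
    by (rule has_derivative_transform_within_open[OF _ assms(1,2)]) (simp add: rep)
qed

lemma linear_dirder_family:
  fixes F :: "'e::euclidean_space \<Rightarrow> 'a::euclidean_space \<Rightarrow> 'b::real_normed_vector"
  assumes "open S" "x \<in> S" and lin: "\<And>y. y \<in> S \<Longrightarrow> linear (F y)"
    and dF: "\<And>i. (\<lambda>y. F y i) differentiable (at x)"
  shows "linear (\<lambda>w. dirder (\<lambda>y. F y w) x h)"
proof (rule linearI)
  show "dirder (\<lambda>y. F y (v + w)) x h = dirder (\<lambda>y. F y v) x h + dirder (\<lambda>y. F y w) x h" for v w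
    using dirder_cong[OF assms(1,2), of "\<lambda>y. F y (v + w)" "\<lambda>y. F y v + F y w"]
      dirder_eqI[OF has_derivative_add[OF dirder_has_derivative[OF dF] dirder_has_derivative[OF dF]]]
    by (simp add: lin linear_add)
  show "dirder (\<lambda>y. F y (r *\<^sub>R w)) x h = r *\<^sub>R dirder (\<lambda>y. F y w) x h" for r w
    using dirder_cong[OF assms(1,2), of "\<lambda>y. F y (r *\<^sub>R w)" "\<lambda>y. r *\<^sub>R F y w"]
      dirder_eqI[OF has_derivative_scaleR_right[OF dirder_has_derivative[OF dF]]]
    by (simp add: lin linear_scale)
qed

text \<open>The mean value theorem, applied once in each of the directions \<open>u\<close> and \<open>v\<close>.\<close>

lemma second_difference_mvt:
  fixes f :: "'e::euclidean_space \<Rightarrow> real"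
  assumes "ball x r \<subseteq> S" "Ck_on 2 S f" "h > 0" "h * (norm u + norm v) < r"
  shows "\<exists>y\<in>ball x r. f (x + h *\<^sub>R u + h *\<^sub>R v) - f (x + h *\<^sub>R u) - f (x + h *\<^sub>R v) + f x
            = h\<^sup>2 * dirder (\<lambda>z. dirder f z u) y v"
proof -
  have d1: "f differentiable (at y)" and d2: "(\<lambda>z. dirder f z u) differentiable (at y)" if "y \<in> S" for y
    using assms(2) that by (auto simp: numeral_2_eq_2)
  have in_ball: "x + s *\<^sub>R u + q *\<^sub>R v \<in> ball x r" if "0 \<le> s" "s \<le> h" "0 \<le> q" "q \<le> h" for s q
  proof -
    have "norm (s *\<^sub>R u + q *\<^sub>R v) \<le> s * norm u + q * norm v"
      using that norm_triangle_ineq[of "s *\<^sub>R u" "q *\<^sub>R v"] by simp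
    also have "\<dots> \<le> h * norm u + h * norm v"
      using that by (intro add_mono mult_right_mono) auto
    finally have "norm (s *\<^sub>R u + q *\<^sub>R v) < r" using assms(4) by (simp add: algebra_simps)
    moreover have "dist x (x + s *\<^sub>R u + q *\<^sub>R v) = norm (s *\<^sub>R u + q *\<^sub>R v)"
      by (metis add.assoc dist_norm norm_minus_commute add_diff_cancel_left')
    ultimately show ?thesis by simp
  qed
  have der1: "((\<lambda>s. f (x + s *\<^sub>R u + q *\<^sub>R v)) has_real_derivative dirder f (x + s *\<^sub>R u + q *\<^sub>R v) u) (at s)"
    if "0 \<le> s" "s \<le> h" "0 \<le> q" "q \<le> h" for s q
  proof -
    have "((\<lambda>s. x + s *\<^sub>R u + q *\<^sub>R v) has_derivative (\<lambda>k. k *\<^sub>R u)) (at s)"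
      by (auto intro!: derivative_eq_intros)
    from has_derivative_compose[OF this dirder_has_derivative[OF d1]]
    have "((\<lambda>s. f (x + s *\<^sub>R u + q *\<^sub>R v)) has_derivative (\<lambda>k. dirder f (x + s *\<^sub>R u + q *\<^sub>R v) (k *\<^sub>R u))) (at s)"
      using in_ball[OF that] assms(1) by auto
    moreover have "dirder f (x + s *\<^sub>R u + q *\<^sub>R v) (k *\<^sub>R u) = dirder f (x + s *\<^sub>R u + q *\<^sub>R v) u * k" for k
      using linear_scale[OF linear_dirder[OF d1]] in_ball[OF that] assms(1) by auto
    ultimately show ?thesis by (simp add: has_field_derivative_def mult_commute_abs)
  qed
  have der2: "((\<lambda>q. dirder f (x + s *\<^sub>R u + q *\<^sub>R v) u) has_real_derivative
      dirder (\<lambda>z. dirder f z u) (x + s *\<^sub>R u + q *\<^sub>R v) v) (at q)"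
    if "0 \<le> s" "s \<le> h" "0 \<le> q" "q \<le> h" for s q
  proof -
    have "((\<lambda>q. x + s *\<^sub>R u + q *\<^sub>R v) has_derivative (\<lambda>k. k *\<^sub>R v)) (at q)"
      by (auto intro!: derivative_eq_intros)
    from has_derivative_compose[OF this dirder_has_derivative[OF d2]]
    have "((\<lambda>q. dirder f (x + s *\<^sub>R u + q *\<^sub>R v) u) has_derivative
        (\<lambda>k. dirder (\<lambda>z. dirder f z u) (x + s *\<^sub>R u + q *\<^sub>R v) (k *\<^sub>R v))) (at q)"
      using in_ball[OF that] assms(1) by auto
    moreover have "dirder (\<lambda>z. dirder f z u) (x + s *\<^sub>R u + q *\<^sub>R v) (k *\<^sub>R v)
        = dirder (\<lambda>z. dirder f z u) (x + s *\<^sub>R u + q *\<^sub>R v) v * k" for k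
      using linear_scale[OF linear_dirder[OF d2]] in_ball[OF that] assms(1) by auto
    ultimately show ?thesis by (simp add: has_field_derivative_def mult_commute_abs)
  qed
  define \<phi> where "\<phi> s = f (x + s *\<^sub>R u + h *\<^sub>R v) - f (x + s *\<^sub>R u + 0 *\<^sub>R v)" for s
  have "\<exists>s. 0 < s \<and> s < h \<and> \<phi> h - \<phi> 0
      = (h - 0) * (dirder f (x + s *\<^sub>R u + h *\<^sub>R v) u - dirder f (x + s *\<^sub>R u + 0 *\<^sub>R v) u)"
    unfolding \<phi>_def using assms(3) der1
    by (intro MVT2) (auto intro!: DERIV_diff simp del: scaleR_zero_left)
  then obtain s where s: "0 < s" "s < h" and e1: "\<phi> h - \<phi> 0
      = h * (dirder f (x + s *\<^sub>R u + h *\<^sub>R v) u - dirder f (x + s *\<^sub>R u + 0 *\<^sub>R v) u)"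
    by auto
  have "\<exists>q. 0 < q \<and> q < h \<and> dirder f (x + s *\<^sub>R u + h *\<^sub>R v) u - dirder f (x + s *\<^sub>R u + 0 *\<^sub>R v) u
      = (h - 0) * dirder (\<lambda>z. dirder f z u) (x + s *\<^sub>R u + q *\<^sub>R v) v"
    using s assms(3) der2 by (intro MVT2) auto
  then obtain q where "0 < q" "q < h" and e2: "dirder f (x + s *\<^sub>R u + h *\<^sub>R v) u - dirder f (x + s *\<^sub>R u + 0 *\<^sub>R v) u
      = h * dirder (\<lambda>z. dirder f z u) (x + s *\<^sub>R u + q *\<^sub>R v) v" by auto
  have "x + s *\<^sub>R u + q *\<^sub>R v \<in> ball x r"
    using in_ball s \<open>0 < q\<close> \<open>q < h\<close> by simp
  moreover have "f (x + h *\<^sub>R u + h *\<^sub>R v) - f (x + h *\<^sub>R u) - f (x + h *\<^sub>R v) + f x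
      = h\<^sup>2 * dirder (\<lambda>z. dirder f z u) (x + s *\<^sub>R u + q *\<^sub>R v) v"
    using e1 unfolding e2 \<phi>_def by (simp add: power2_eq_square)
  ultimately show ?thesis by blast
qed

text \<open>The second difference quotient of \<open>f\<close> does not change when \<open>u\<close> and \<open>v\<close> are exchanged, and by
  the preceding lemma it is, up to the square of the step size, a value of either mixed derivative at a
  nearby point.\<close>

lemma dirder_commute_real:
  fixes f :: "'e::euclidean_space \<Rightarrow> real"
  assumes "open S" "x \<in> S" "Ck_on 2 S f"
  shows "dirder (\<lambda>z. dirder f z u) x v = dirder (\<lambda>z. dirder f z v) x u"
proof -
  define a where "a y = dirder (\<lambda>z. dirder f z u) y v" for y
  define b where "b y = dirder (\<lambda>z. dirder f z v) y u" for y
  have "continuous_on S a" "continuous_on S b"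
    using assms(3) unfolding a_def b_def numeral_2_eq_2 by simp_all
  then have ca: "isCont a x" and cb: "isCont b x"
    using assms(1,2) continuous_on_eq_continuous_at by blast+
  have "\<bar>a x - b x\<bar> \<le> e" if e: "e > 0" for e
  proof -
    obtain r1 where r1: "r1 > 0" "\<And>y. dist y x < r1 \<Longrightarrow> dist (a y) (a x) < e / 2"
      using ca half_gt_zero[OF e] unfolding continuous_at_eps_delta by blast
    obtain r2 where r2: "r2 > 0" "\<And>y. dist y x < r2 \<Longrightarrow> dist (b y) (b x) < e / 2"
      using cb half_gt_zero[OF e] unfolding continuous_at_eps_delta by blast
    obtain r3 where r3: "r3 > 0" "ball x r3 \<subseteq> S" using assms open_contains_ball by blast
    define r where "r = min r1 (min r2 r3)"
    have r: "r > 0" "ball x r \<subseteq> S" using r1 r2 r3 unfolding r_def by auto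
    define N where "N = norm u + norm v + 1"
    have N: "N > 0" unfolding N_def by (simp add: add_nonneg_pos)
    define h where "h = r / (2 * N)"
    have h: "h > 0" unfolding h_def using r N by simp
    have "h * N = r / 2"
      unfolding h_def using N by simp
    then have h': "h * (norm u + norm v) < r" "h * (norm v + norm u) < r"
      using h r unfolding N_def by (simp_all add: algebra_simps)
    obtain y where y: "y \<in> ball x r" "f (x + h *\<^sub>R u + h *\<^sub>R v) - f (x + h *\<^sub>R u) - f (x + h *\<^sub>R v) + f x = h\<^sup>2 * a y"
      using second_difference_mvt[OF r(2) assms(3) h h'(1)] unfolding a_def by blast
    obtain y' where y': "y' \<in> ball x r" "f (x + h *\<^sub>R v + h *\<^sub>R u) - f (x + h *\<^sub>R v) - f (x + h *\<^sub>R u) + f x = h\<^sup>2 * b y'"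
      using second_difference_mvt[OF r(2) assms(3) h h'(2)] unfolding b_def by blast
    have swap: "x + h *\<^sub>R v + h *\<^sub>R u = x + h *\<^sub>R u + h *\<^sub>R v" by (simp add: algebra_simps)
    have "h\<^sup>2 * a y = h\<^sup>2 * b y'" using y(2) y'(2) unfolding swap by linarith
    then have "a y = b y'" using h by simp
    moreover have "dist y x < r" "dist y' x < r"
      using y(1) y'(1) by (simp_all add: dist_commute)
    then have "dist (a y) (a x) < e / 2" "dist (b y') (b x) < e / 2"
      using r1(2)[of y] r2(2)[of y'] unfolding r_def by simp_all
    ultimately show ?thesis unfolding dist_real_def by linarith
  qed
  then have "\<bar>a x - b x\<bar> \<le> 0" by (rule dense_ge)
  then show ?thesis unfolding a_def b_def by simp
qed

lemma dirder_inner_left: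
  assumes "f differentiable (at x)"
  shows "dirder (\<lambda>y. f y \<bullet> i) x v = dirder f x v \<bullet> i"
  by (rule dirder_eqI[OF has_derivative_inner_left[OF dirder_has_derivative[OF assms]]])

lemma dirder_commute:
  fixes f :: "'e::euclidean_space \<Rightarrow> 'b::euclidean_space"
  assumes "open S" "x \<in> S" "smooth_on S f"
  shows "dirder (\<lambda>z. dirder f z u) x v = dirder (\<lambda>z. dirder f z v) x u"
proof (rule euclidean_eqI)
  fix i :: 'b
  have e: "dirder (\<lambda>z. dirder (\<lambda>y. f y \<bullet> i) z u) x v = dirder (\<lambda>z. dirder f z u) x v \<bullet> i" for u v
  proof -
    have "dirder (\<lambda>z. dirder (\<lambda>y. f y \<bullet> i) z u) x v = dirder (\<lambda>z. dirder f z u \<bullet> i) x v"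
      by (intro fun_cong[OF dirder_cong[OF assms(1,2)]] dirder_inner_left smooth_on_differentiable[OF assms(3)])
    also have "\<dots> = dirder (\<lambda>z. dirder f z u) x v \<bullet> i"
      using assms by (intro dirder_inner_left smooth_on_differentiable[OF smooth_on_dirder])
    finally show ?thesis .
  qed
  have "Ck_on 2 S (\<lambda>y. f y \<bullet> i)"
    using assms(3) unfolding smooth_on_def
    by (intro Ck_on_bounded_linear[OF assms(1) bounded_linear_inner_left]) auto
  from dirder_commute_real[OF assms(1,2) this]
  show "dirder (\<lambda>z. dirder f z u) x v \<bullet> i = dirder (\<lambda>z. dirder f z v) x u \<bullet> i"
    unfolding e .
qed

lemma differentiable_linear_family:
  fixes F :: "'e::euclidean_space \<Rightarrow> 'a::euclidean_space \<Rightarrow> 'b::real_normed_vector"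
  assumes "open S" "x \<in> S" "\<And>y. y \<in> S \<Longrightarrow> linear (F y)"
    "\<And>i. (\<lambda>y. F y i) differentiable (at x)" "X differentiable (at x)"
  shows "(\<lambda>y. F y (X y)) differentiable (at x)"
  using has_derivative_linear_family[OF assms] differentiableI by blast

lemma dirder_linear_family:
  fixes F :: "'e::euclidean_space \<Rightarrow> 'a::euclidean_space \<Rightarrow> 'b::real_normed_vector"
  assumes "open S" "x \<in> S" "\<And>y. y \<in> S \<Longrightarrow> linear (F y)"
    "\<And>i. (\<lambda>y. F y i) differentiable (at x)" "X differentiable (at x)"
  shows "dirder (\<lambda>y. F y (X y)) x h = dirder (\<lambda>y. F y (X x)) x h + F x (dirder X x h)"
  by (rule dirder_eqI[OF has_derivative_linear_family[OF assms]])

lemma smooth_on_linear_family: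
  fixes F :: "'e::euclidean_space \<Rightarrow> 'a::euclidean_space \<Rightarrow> 'b::real_normed_vector"
  assumes "open S" "\<And>x. x \<in> S \<Longrightarrow> linear (F x)"
    and "\<And>i. smooth_on S (\<lambda>x. F x i)" "smooth_on S X"
  shows "smooth_on S (\<lambda>x. F x (X x))"
  using assms unfolding smooth_on_def by (auto intro: Ck_on_linear_family)

lemma Ck_on_diff:
  assumes "open S" "Ck_on k S f" "Ck_on k S h"
  shows "Ck_on k S (\<lambda>x. f x - h x)"
  using Ck_on_add[OF assms(1,2) Ck_on_bounded_linear[OF assms(1) bounded_linear_minus[OF bounded_linear_ident] assms(3)]]
  by simp

lemma smooth_on_const: "smooth_on S (\<lambda>x. c)"
  by (simp add: smooth_on_def Ck_on_const)

lemma smooth_on_add: "open S \<Longrightarrow> smooth_on S f \<Longrightarrow> smooth_on S h \<Longrightarrow> smooth_on S (\<lambda>x. f x + h x)"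
  unfolding smooth_on_def by (auto intro: Ck_on_add)

lemma smooth_on_diff: "open S \<Longrightarrow> smooth_on S f \<Longrightarrow> smooth_on S h \<Longrightarrow> smooth_on S (\<lambda>x. f x - h x)"
  unfolding smooth_on_def by (auto intro: Ck_on_diff)

lemma smooth_on_bounded_linear:
  "open S \<Longrightarrow> bounded_linear L \<Longrightarrow> smooth_on S f \<Longrightarrow> smooth_on S (\<lambda>x. L (f x))"
  unfolding smooth_on_def by (auto intro: Ck_on_bounded_linear)

lemma smooth_on_sum:
  "open S \<Longrightarrow> (\<And>i. i \<in> I \<Longrightarrow> smooth_on S (f i)) \<Longrightarrow> smooth_on S (\<lambda>x. \<Sum>i\<in>I. f i x)"
  unfolding smooth_on_def by (auto intro: Ck_on_sum)

lemma smooth_on_scaleR: "open S \<Longrightarrow> smooth_on S f \<Longrightarrow> smooth_on S h \<Longrightarrow> smooth_on S (\<lambda>x. f x *\<^sub>R h x)"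
  for f :: "'e::euclidean_space \<Rightarrow> real"
  unfolding smooth_on_def by (auto intro: Ck_on_scaleR)

lemma smooth_on_bilinear_family:
  fixes B :: "'e::euclidean_space \<Rightarrow> 'e \<Rightarrow> 'e \<Rightarrow> real"
  assumes S: "open S" and B: "\<And>x. x \<in> S \<Longrightarrow> bilinear (B x)" "\<And>u v. smooth_on S (\<lambda>x. B x u v)"
    and X: "smooth_on S X" "smooth_on S Y"
  shows "smooth_on S (\<lambda>x. B x (X x) (Y x))"
proof -
  have l: "linear (\<lambda>u. B x u v)" "linear (B x u)" if "x \<in> S" for x u v
    using B(1)[OF that] by (auto simp: bilinear_def)
  have sB: "smooth_on S (\<lambda>x. B x u (Y x))" for u
    by (rule smooth_on_linear_family[where F = "\<lambda>x. B x u", OF S l(2) B(2) X(2)])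
  show ?thesis
    by (rule smooth_on_linear_family[where F = "\<lambda>x u. B x u (Y x)", OF S l(1) sB X(1)])
qed

text \<open>The principle that removes the exceptional values of \<open>t\<close>. If \<open>f x\<close> were nonzero, \<open>t\<close> would take
  values in the finite set \<open>F\<close> on a whole ball around \<open>x\<close>, hence be constant there.\<close>

lemma zero_by_density:
  fixes t f :: "'e::euclidean_space \<Rightarrow> real"
  assumes S: "open S" "x \<in> S" and t: "continuous_on S t" and f: "continuous_on S f" and F: "finite F"
    and good: "\<And>y. y \<in> S \<Longrightarrow> t y \<notin> F \<Longrightarrow> f y = 0"
    and flat: "\<And>T c. open T \<Longrightarrow> x \<in> T \<Longrightarrow> T \<subseteq> S \<Longrightarrow> (\<And>y. y \<in> T \<Longrightarrow> t y = c) \<Longrightarrow> f x = 0"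
  shows "f x = 0"
proof (rule ccontr)
  assume nz: "f x \<noteq> 0"
  have "open (f -` (- {0}) \<inter> S)"
    using continuous_on_open_vimage[OF S(1)] f by (metis open_Compl closed_singleton)
  moreover have "x \<in> f -` (- {0}) \<inter> S" using nz S by simp
  ultimately obtain r where r: "r > 0" "ball x r \<subseteq> f -` (- {0}) \<inter> S"
    using open_contains_ball by blast
  have "t ` ball x r \<subseteq> F" using good r(2) by auto
  then have "finite (t ` ball x r)" using F finite_subset by blast
  moreover have "continuous_on (ball x r) t" using continuous_on_subset[OF t] r(2) by blast
  ultimately have "t constant_on ball x r"
    using continuous_finite_range_constant[OF connected_ball] by blast
  then obtain c where "\<And>y. y \<in> ball x r \<Longrightarrow> t y = c" unfolding constant_on_def by blast
  then have "f x = 0" using r by (intro flat[of "ball x r"]) auto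
  with nz show False by simp
qed

section \<open>Inner products and the Riesz isomorphism\<close>

definition inner_form :: "('e::euclidean_space \<Rightarrow> 'e \<Rightarrow> real) \<Rightarrow> bool" where
  "inner_form B \<longleftrightarrow> bilinear B \<and> (\<forall>u v. B u v = B v u) \<and> (\<forall>v. v \<noteq> 0 \<longrightarrow> B v v > 0)"

definition riesz :: "('e::euclidean_space \<Rightarrow> 'e \<Rightarrow> real) \<Rightarrow> ('e \<Rightarrow> real) \<Rightarrow> 'e" where
  "riesz B \<beta> = (THE w. \<forall>z. B w z = \<beta> z)"

lemma linear_functional_inner:
  fixes f :: "'e::euclidean_space \<Rightarrow> real"
  assumes "linear f"
  shows "(\<Sum>i\<in>Basis. f i *\<^sub>R i) \<bullet> z = f z"
  unfolding inner_sum_left inner_scaleR_left linear_basis_expansion[OF assms, of z]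
  by (simp add: inner_commute[of z] mult.commute)

lemma inner_form_eqI:
  assumes "inner_form B" "\<And>z. B v z = B w z"
  shows "v = w"
proof -
  have "B (v - w) (v - w) = B v (v - w) - B w (v - w)"
    using assms(1) by (simp only: inner_form_def bilinear_lsub)
  then have "B (v - w) (v - w) = 0" using assms(2) by simp
  then show ?thesis using assms(1) unfolding inner_form_def
    by (metis less_irrefl right_minus_eq)
qed

lemma inner_form_linear_right: "inner_form B \<Longrightarrow> linear (B v)"
  by (simp add: inner_form_def bilinear_def)

lemma inner_form_linear_left: "inner_form B \<Longrightarrow> linear (\<lambda>u. B u v)"
  by (simp add: inner_form_def bilinear_def)

lemma riesz_eqI:
  assumes "inner_form B" "\<And>z. B w z = \<beta> z"
  shows "riesz B \<beta> = w"
  unfolding riesz_def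
proof (rule the_equality)
  show "\<forall>z. B w z = \<beta> z" using assms(2) by simp
  show "v = w" if "\<forall>z. B v z = \<beta> z" for v
    using that assms(2) by (intro inner_form_eqI[OF assms(1)]) simp
qed

lemma riesz:
  assumes B: "inner_form B" and \<beta>: "linear \<beta>"
  shows "B (riesz B \<beta>) z = \<beta> z"
proof -
  define L where "L w = (\<Sum>i\<in>Basis. B w i *\<^sub>R i)" for w
  have L_inner: "L w \<bullet> z = B w z" for w z
    unfolding L_def by (rule linear_functional_inner[OF inner_form_linear_right[OF B]])
  have "linear L"
    by (rule linearI; rule euclidean_eqI)
      (simp_all add: L_inner inner_add_left linear_add[OF inner_form_linear_left[OF B]]
        linear_scale[OF inner_form_linear_left[OF B]])
  moreover have "inj L"
    by (rule injI, rule inner_form_eqI[OF B]) (simp flip: L_inner)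
  ultimately have "surj L" by (rule linear_inj_imp_surj)
  then obtain w where w: "L w = (\<Sum>i\<in>Basis. \<beta> i *\<^sub>R i)" by (metis surjD)
  have "B w z = \<beta> z" for z
    using linear_functional_inner[OF \<beta>] by (simp add: w flip: L_inner)
  then show ?thesis using riesz_eqI[OF B] by blast
qed

text \<open>Written as \<open>L x w = c x\<close>, the equation for the representing vector \<open>w\<close> is solved by inverting the
  map \<open>(x, w) \<mapsto> (x, L x w)\<close>; its derivative is invertible because every \<open>L x\<close> is. A left
  inverse of a continuous map between open sets of the same dimension is differentiable at the image
  of every point where the map has an invertible derivative.\<close>

lemma riesz_differentiable:
  fixes G :: "'e::euclidean_space \<Rightarrow> 'e \<Rightarrow> 'e \<Rightarrow> real"
  assumes S: "open S" "x \<in> S" and G: "\<And>y. y \<in> S \<Longrightarrow> inner_form (G y)"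
    and dG: "\<And>y u v. y \<in> S \<Longrightarrow> (\<lambda>y. G y u v) differentiable (at y)"
    and \<beta>: "\<And>y. y \<in> S \<Longrightarrow> linear (\<beta> y)" and d\<beta>: "\<And>z. (\<lambda>y. \<beta> y z) differentiable (at x)"
  shows "(\<lambda>y. riesz (G y) (\<beta> y)) differentiable (at x)"
proof -
  define L where "L y w = (\<Sum>i\<in>Basis. G y w i *\<^sub>R i)" for y w
  have L_inner: "L y w \<bullet> z = G y w z" if "y \<in> S" for y w z
    unfolding L_def by (rule linear_functional_inner[OF inner_form_linear_right[OF G[OF that]]])
  have linL: "linear (L y)" if "y \<in> S" for y
    by (rule linearI; rule euclidean_eqI)
      (simp_all add: L_inner[OF that] inner_add_left linear_add[OF inner_form_linear_left[OF G[OF that]]]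
        linear_scale[OF inner_form_linear_left[OF G[OF that]]])
  have dL: "(\<lambda>y. L y w) differentiable (at y)" if "y \<in> S" for y w
    unfolding L_def using dG[OF that] by (auto intro!: differentiable_sum differentiable_scaleR)
  define T where "T = S \<times> (UNIV :: 'e set)"
  have T: "open T" unfolding T_def using S by (simp add: open_Times)
  \<comment> \<open>\<open>K\<close> is a left inverse of \<open>F\<close>, and the value of interest is a component of \<open>K (x, c x)\<close>.\<close>
  define F where "F p = (fst p, L (fst p) (snd p))" for p
  define K where "K q = (fst q, riesz (G (fst q)) (\<lambda>z. snd q \<bullet> z))" for q
  have derL: "((\<lambda>p. L (fst p) w) has_derivative (\<lambda>h. dirder (\<lambda>y. L y w) (fst p) (fst h))) (at p)"
    if "p \<in> T" for p and w
    using that unfolding T_def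
    by (intro has_derivative_compose[OF has_derivative_fst[OF has_derivative_ident] dirder_has_derivative[OF dL]]) auto
  have derF: "(F has_derivative
      (\<lambda>h. (fst h, dirder (\<lambda>y. L y (snd p)) (fst p) (fst h) + L (fst p) (snd h)))) (at p)"
    if "p \<in> T" for p
  proof -
    have "((\<lambda>p. L (fst p) (snd p)) has_derivative
       (\<lambda>h. dirder (\<lambda>q. L (fst q) (snd p)) p h + L (fst p) (dirder snd p h))) (at p)"
      using derL[OF that] that linL unfolding T_def
      by (intro has_derivative_linear_family[OF T[unfolded T_def]])
        (auto intro: differentiableI has_derivative_snd[OF has_derivative_ident])
    moreover have "dirder (\<lambda>q. L (fst q) (snd p)) p h = dirder (\<lambda>y. L y (snd p)) (fst p) (fst h)" for h
      by (rule dirder_eqI[OF derL[OF that]])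
    moreover have "dirder snd p h = snd h" for h
      by (rule dirder_eqI[OF has_derivative_snd[OF has_derivative_ident]])
    ultimately show ?thesis unfolding F_def
      by (intro has_derivative_Pair has_derivative_fst[OF has_derivative_ident]) simp
  qed
  have KF: "K (F p) = p" if "p \<in> T" for p
  proof -
    have "riesz (G (fst p)) (\<lambda>z. L (fst p) (snd p) \<bullet> z) = snd p"
      using that unfolding T_def by (intro riesz_eqI[OF G]) (auto simp: L_inner)
    then show ?thesis unfolding K_def F_def by simp
  qed
  define w where "w = riesz (G x) (\<beta> x)"
  have xw: "(x, w) \<in> T" unfolding T_def using S by simp
  define D where "D h = dirder (\<lambda>y. L y w) x h" for h
  have cL: "L x (riesz (G x) (\<lambda>z. k \<bullet> z)) = k" for k
    by (rule euclidean_eqI)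
       (auto simp: L_inner S(2) intro!: riesz[OF G[OF S(2)]] bounded_linear.linear bounded_linear_inner_right)
  have "(K has_derivative (\<lambda>h. (fst h, riesz (G x) (\<lambda>z. (snd h - D (fst h)) \<bullet> z)))) (at (F (x, w)))"
  proof (rule has_derivative_inverse_strong[OF T xw _ KF derF[OF xw]])
    show "continuous_on T F"
      using derF has_derivative_continuous by (blast intro!: continuous_at_imp_continuous_on)
    show "(\<lambda>h. (fst h, dirder (\<lambda>y. L y (snd (x, w))) (fst (x, w)) (fst h) + L (fst (x, w)) (snd h))) \<circ>
      (\<lambda>h. (fst h, riesz (G x) (\<lambda>z. (snd h - D (fst h)) \<bullet> z))) = id"
      by (auto simp: fun_eq_iff cL D_def)
  qed
  then have "K differentiable (at (F (x, w)))" by (rule differentiableI)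
  moreover define c where "c y = (\<Sum>i\<in>Basis. \<beta> y i *\<^sub>R i)" for y
  have c_inner: "c y \<bullet> z = \<beta> y z" if "y \<in> S" for y z
    unfolding c_def by (rule linear_functional_inner[OF \<beta>[OF that]])
  have "L x w = c x"
    by (rule euclidean_eqI) (simp add: w_def L_inner[OF S(2)] riesz[OF G[OF S(2)] \<beta>[OF S(2)]] c_inner[OF S(2)])
  ultimately have dK: "K differentiable (at (x, c x))" by (simp add: F_def)
  have "c differentiable (at x)"
    unfolding c_def using d\<beta> by (auto intro!: differentiable_sum differentiable_scaleR)
  then have "(\<lambda>y. (y, c y)) differentiable (at x)"
    using dirder_has_derivative has_derivative_Pair[OF has_derivative_ident] differentiableI by blast
  then have "(\<lambda>y. K (y, c y)) differentiable (at x)"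
    using dK differentiable_chain_at[of "\<lambda>y. (y, c y)" x K] by (simp add: o_def)
  then have "(\<lambda>y. snd (K (y, c y))) differentiable (at x)"
    using dirder_has_derivative has_derivative_snd differentiableI by blast
  moreover have "snd (K (y, c y)) = riesz (G y) (\<beta> y)" if "y \<in> S" for y
  proof -
    have "(\<lambda>z. c y \<bullet> z) = \<beta> y" using c_inner[OF that] by (simp add: fun_eq_iff)
    then show ?thesis unfolding K_def by simp
  qed
  ultimately show ?thesis
    using differentiable_cong[OF S, of "\<lambda>y. snd (K (y, c y))" "\<lambda>y. riesz (G y) (\<beta> y)"] by blast
qed

text \<open>Reduces a representing vector with merely continuous coefficients \<open>\<beta>\<close> to the differentiable ones
  of the coordinate functionals.\<close>

lemma riesz_expansion:
  assumes B: "inner_form B" and \<beta>: "linear \<beta>"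
  shows "riesz B \<beta> = (\<Sum>i\<in>Basis. \<beta> i *\<^sub>R riesz B (\<lambda>z. z \<bullet> i))"
proof (rule riesz_eqI[OF B])
  fix z
  have "B (riesz B (\<lambda>z. z \<bullet> i)) z = z \<bullet> i" for i
    by (intro riesz[OF B] bounded_linear.linear bounded_linear_inner_left)
  then show "B (\<Sum>i\<in>Basis. \<beta> i *\<^sub>R riesz B (\<lambda>z. z \<bullet> i)) z = \<beta> z"
    using linear_basis_expansion[OF \<beta>, of z]
    by (simp add: linear_sum[OF inner_form_linear_left[OF B]]
        linear_scale[OF inner_form_linear_left[OF B]] mult.commute)
qed

text \<open>Differentiating \<open>G x (w x) z = \<beta> x z\<close> shows that a derivative of the representing vector \<open>w\<close>
  represents the functional \<open>z \<mapsto> \<partial>\<beta> z - (\<partial>G) w z\<close>, which involves \<open>w\<close> but no derivative of it; so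
  each order of differentiability yields the next one.\<close>

lemma Ck_on_riesz:
  fixes G :: "'e::euclidean_space \<Rightarrow> 'e \<Rightarrow> 'e \<Rightarrow> real"
  assumes S: "open S" and G: "\<And>y. y \<in> S \<Longrightarrow> inner_form (G y)"
    and sG: "\<And>u v. smooth_on S (\<lambda>y. G y u v)"
    and "\<And>y. y \<in> S \<Longrightarrow> linear (\<beta> y)" and "\<And>z. Ck_on k S (\<lambda>y. \<beta> y z)"
  shows "Ck_on k S (\<lambda>y. riesz (G y) (\<beta> y))"
  using assms(4,5)
proof (induction k arbitrary: \<beta>)
  case 0
  have "(\<lambda>y. riesz (G y) (\<lambda>z. z \<bullet> i)) differentiable (at x)" if "x \<in> S" for x i
    by (intro riesz_differentiable[OF S that G smooth_on_differentiable[OF sG]]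
        bounded_linear.linear bounded_linear_inner_left) auto
  then have "continuous_on S (\<lambda>y. riesz (G y) (\<lambda>z. z \<bullet> i))" for i
    by (auto intro!: continuous_at_imp_continuous_on differentiable_imp_continuous_within)
  then have "continuous_on S (\<lambda>y. \<Sum>i\<in>Basis. \<beta> y i *\<^sub>R riesz (G y) (\<lambda>z. z \<bullet> i))"
    using 0(2) by (intro continuous_intros) simp_all
  then show ?case
    using riesz_expansion[OF G 0(1)] by (simp cong: continuous_on_cong)
next
  case (Suc k)
  let ?w = "\<lambda>y. riesz (G y) (\<beta> y)"
  have d\<beta>: "(\<lambda>y. \<beta> y z) differentiable (at x)" if "x \<in> S" for x z
    using Suc.prems(2) that by auto
  have dG: "(\<lambda>y. G y u v) differentiable (at x)" if "x \<in> S" for x u v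
    using smooth_on_differentiable[OF sG that] .
  have dw: "?w differentiable (at x)" if "x \<in> S" for x
    using that d\<beta> dG Suc.prems(1) by (intro riesz_differentiable[OF S that G]) auto
  have linG: "linear (\<lambda>u. G y u v)" if "y \<in> S" for y v
    using inner_form_linear_left[OF G[OF that]] .
  have linDG: "linear (\<lambda>z. dirder (\<lambda>y. G y u z) x h)" if "x \<in> S" for x u h
    using dG[OF that] inner_form_linear_right[OF G] by (intro linear_dirder_family[OF S that])
  have linDG': "linear (\<lambda>u. dirder (\<lambda>y. G y u z) x h)" if "x \<in> S" for x z h
    using dG[OF that] linG by (intro linear_dirder_family[OF S that])
  have linD\<beta>: "linear (\<lambda>z. dirder (\<lambda>y. \<beta> y z) x h)" if "x \<in> S" for x h
    using d\<beta>[OF that] Suc.prems(1) by (intro linear_dirder_family[OF S that])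
  have eq: "dirder ?w x h = riesz (G x) (\<lambda>z. dirder (\<lambda>y. \<beta> y z) x h - dirder (\<lambda>y. G y (?w x) z) x h)"
    if "x \<in> S" for x h
  proof (rule riesz_eqI[OF G[OF that], symmetric])
    fix z
    have "dirder (\<lambda>y. \<beta> y z) x h = dirder (\<lambda>y. G y (?w y) z) x h"
      using Suc.prems(1) by (intro fun_cong[OF dirder_cong[OF S that]]) (simp add: riesz[OF G])
    also have "\<dots> = dirder (\<lambda>y. G y (?w x) z) x h + G x (dirder ?w x h) z"
      using dG[OF that] dw[OF that] linG by (intro dirder_linear_family[OF S that, of "\<lambda>y u. G y u z"]) auto
    finally show "G x (dirder ?w x h) z = dirder (\<lambda>y. \<beta> y z) x h - dirder (\<lambda>y. G y (?w x) z) x h"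
      by simp
  qed
  have "Ck_on k S (\<lambda>x. riesz (G x) (\<lambda>z. dirder (\<lambda>y. \<beta> y z) x h - dirder (\<lambda>y. G y (?w x) z) x h))" for h
  proof (rule Suc.IH)
    show "linear (\<lambda>z. dirder (\<lambda>y. \<beta> y z) x h - dirder (\<lambda>y. G y (?w x) z) x h)" if "x \<in> S" for x
      using linD\<beta>[OF that] linDG[OF that] by (intro linear_compose_sub)
    fix z
    have sw: "Ck_on k S ?w"
      using Suc.prems Ck_on_Suc_imp by (intro Suc.IH) blast+
    have sDG: "Ck_on k S (\<lambda>x. dirder (\<lambda>y. G y u z) x h)" for u
      using smooth_on_dirder[OF sG] unfolding smooth_on_def by blast
    have "Ck_on k S (\<lambda>x. (\<lambda>x u. dirder (\<lambda>y. G y u z) x h) x (?w x))"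
      by (rule Ck_on_linear_family[OF S _ _ sw]) (rule linDG', assumption, rule sDG)
    moreover have "Ck_on k S (\<lambda>x. dirder (\<lambda>y. \<beta> y z) x h)" using Suc.prems(2)[of z] by simp
    ultimately show "Ck_on k S (\<lambda>x. dirder (\<lambda>y. \<beta> y z) x h - dirder (\<lambda>y. G y (?w x) z) x h)"
      by (intro Ck_on_diff[OF S])
  qed
  then show ?case using dw Ck_on_cong[OF S eq] by auto
qed

lemma smooth_on_riesz:
  fixes G :: "'e::euclidean_space \<Rightarrow> 'e \<Rightarrow> 'e \<Rightarrow> real"
  assumes "open S" "\<And>y. y \<in> S \<Longrightarrow> inner_form (G y)" "\<And>u v. smooth_on S (\<lambda>y. G y u v)"
    and "\<And>y. y \<in> S \<Longrightarrow> linear (\<beta> y)" and "\<And>z. smooth_on S (\<lambda>y. \<beta> y z)"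
  shows "smooth_on S (\<lambda>y. riesz (G y) (\<beta> y))"
  unfolding smooth_on_def
proof
  show "Ck_on k S (\<lambda>y. riesz (G y) (\<beta> y))" for k
    using assms(5) unfolding smooth_on_def by (intro Ck_on_riesz[OF assms(1-4)]) blast+
qed

section \<open>The Levi-Civita connection and its curvature\<close>

definition endo_trace :: "('e::euclidean_space \<Rightarrow> 'e) \<Rightarrow> real" where
  "endo_trace f = (\<Sum>i\<in>Basis. f i \<bullet> i)"

lemma endo_trace_add: "endo_trace (\<lambda>u. f u + h u) = endo_trace f + endo_trace h"
  and endo_trace_diff: "endo_trace (\<lambda>u. f u - h u) = endo_trace f - endo_trace h"
  and endo_trace_scaleR: "endo_trace (\<lambda>u. c *\<^sub>R f u) = c * endo_trace f"
  by (simp_all add: endo_trace_def inner_add_left inner_diff_left sum.distrib sum_subtractf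
      sum_distrib_left)

lemma endo_trace_ident: "endo_trace (\<lambda>u::'e::euclidean_space. u) = DIM('e)"
  by (simp add: endo_trace_def)

lemma endo_trace_rank_one:
  fixes f :: "'e::euclidean_space \<Rightarrow> real"
  assumes "linear f"
  shows "endo_trace (\<lambda>u. f u *\<^sub>R v) = f v"
  using linear_functional_inner[OF assms, of v]
  unfolding inner_sum_left inner_scaleR_left by (simp add: endo_trace_def inner_commute)

lemma endo_trace_comp_commute:
  fixes f h :: "'e::euclidean_space \<Rightarrow> 'e"
  assumes "linear f" "linear h"
  shows "endo_trace (\<lambda>u. f (h u)) = endo_trace (\<lambda>u. h (f u))"
proof -
  have "endo_trace (\<lambda>u. f (h u)) = (\<Sum>i\<in>Basis. \<Sum>j\<in>Basis. (h i \<bullet> j) * (f j \<bullet> i))"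
    if "linear f" "linear h" for f h :: "'e \<Rightarrow> 'e"
    unfolding endo_trace_def
    by (subst linear_basis_expansion[OF that(1)]) (simp add: inner_sum_left)
  from this[OF assms] this[OF assms(2,1)] show ?thesis
    by (subst (asm) (2) sum.swap) (simp add: mult.commute)
qed

lemma ricci_trace: "ricci G x v w = endo_trace (\<lambda>u. curvature G x u v w)"
  by (simp add: ricci_def endo_trace_def)

locale metric_on =
  fixes S :: "'e::euclidean_space set" and G :: "'e \<Rightarrow> 'e \<Rightarrow> 'e \<Rightarrow> real"
  assumes open_S: "open S"
    and G: "x \<in> S \<Longrightarrow> inner_form (G x)"
    and smooth_G: "smooth_on S (\<lambda>x. G x u v)"
begin

abbreviation \<Gamma> where "\<Gamma> \<equiv> christoffel G"
abbreviation R where "R \<equiv> curvature G"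

lemma G_sym: "x \<in> S \<Longrightarrow> G x u v = G x v u"
  using G by (simp add: inner_form_def)

lemma bilinear_G: "x \<in> S \<Longrightarrow> bilinear (G x)"
  using G by (simp add: inner_form_def)

lemma linear_G: "x \<in> S \<Longrightarrow> linear (G x u)" "x \<in> S \<Longrightarrow> linear (\<lambda>u. G x u v)"
  using bilinear_G by (auto simp: bilinear_def)

lemmas G_linear = linear_add[OF linear_G(1)] linear_add[OF linear_G(2)]
  linear_diff[OF linear_G(1)] linear_diff[OF linear_G(2)]
  linear_neg[OF linear_G(1)] linear_neg[OF linear_G(2)]
  linear_scale[OF linear_G(1)] linear_scale[OF linear_G(2)]
  linear_0[OF linear_G(1)] linear_0[OF linear_G(2)]

lemma differentiable_G: "x \<in> S \<Longrightarrow> (\<lambda>x. G x u v) differentiable (at x)"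
  using smooth_on_differentiable[OF smooth_G] .

lemma linear_DG:
  assumes "x \<in> S"
  shows "linear (\<lambda>z. dirder (\<lambda>y. G y u z) x h)" "linear (\<lambda>z. dirder (\<lambda>y. G y z v) x h)"
    "linear (\<lambda>z. dirder (\<lambda>y. G y u v) x z)"
  using assms linear_G differentiable_G
  by (auto intro!: linear_dirder_family[OF open_S] linear_dirder)

lemmas DG_linear =
  linear_add[OF linear_DG(1)] linear_add[OF linear_DG(2)] linear_add[OF linear_DG(3)]
  linear_scale[OF linear_DG(1)] linear_scale[OF linear_DG(2)] linear_scale[OF linear_DG(3)]

text \<open>The covector that is dual to \<open>\<Gamma>(u,v)\<close>, by the Koszul formula for constant vector fields.\<close>

definition koszul :: "'e \<Rightarrow> 'e \<Rightarrow> 'e \<Rightarrow> 'e \<Rightarrow> real" where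
  "koszul x u v z = (dirder (\<lambda>y. G y v z) x u + dirder (\<lambda>y. G y u z) x v - dirder (\<lambda>y. G y u v) x z) / 2"

lemma linear_koszul:
  assumes "x \<in> S" shows "linear (koszul x u v)"
  unfolding koszul_def by (rule linearI) (simp_all add: DG_linear[OF assms] field_simps)

lemma christoffel_riesz: "\<Gamma> x u v = riesz (G x) (koszul x u v)"
  unfolding christoffel_def riesz_def koszul_def by (rule arg_cong[of _ _ The]) (simp add: fun_eq_iff eq_divide_eq mult.commute)

lemma G_christoffel:
  assumes "x \<in> S"
  shows "2 * G x (\<Gamma> x u v) z
      = dirder (\<lambda>y. G y v z) x u + dirder (\<lambda>y. G y u z) x v - dirder (\<lambda>y. G y u v) x z"
  using riesz[OF G[OF assms] linear_koszul[OF assms], of u v z]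
  by (simp add: christoffel_riesz koszul_def)

lemma dirder_G_sym: "x \<in> S \<Longrightarrow> dirder (\<lambda>y. G y u v) x = dirder (\<lambda>y. G y v u) x"
  by (rule dirder_cong[OF open_S]) (auto simp: G_sym)

lemma christoffel_sym: "x \<in> S \<Longrightarrow> \<Gamma> x u v = \<Gamma> x v u"
  unfolding christoffel_riesz koszul_def
  by (rule arg_cong[of _ _ "riesz (G x)"]) (simp add: fun_eq_iff dirder_G_sym[of x u v] add.commute)

lemma linear_christoffel:
  assumes x: "x \<in> S"
  shows "linear (\<Gamma> x u)" "linear (\<lambda>u. \<Gamma> x u v)"
proof -
  show 1: "linear (\<Gamma> x u)" for u
  proof (rule linearI; rule inner_form_eqI[OF G[OF x]])
    fix v w z and r :: real
    have "2 * G x (\<Gamma> x u (v + w)) z = 2 * G x (\<Gamma> x u v + \<Gamma> x u w) z"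
      unfolding G_linear(2)[OF x] distrib_left G_christoffel[OF x]
      by (simp add: DG_linear[OF x])
    then show "G x (\<Gamma> x u (v + w)) z = G x (\<Gamma> x u v + \<Gamma> x u w) z" by simp
    have "2 * G x (\<Gamma> x u (r *\<^sub>R v)) z = r * (2 * G x (\<Gamma> x u v) z)"
      unfolding G_christoffel[OF x]
      by (simp add: DG_linear[OF x] algebra_simps)
    then show "G x (\<Gamma> x u (r *\<^sub>R v)) z = G x (r *\<^sub>R \<Gamma> x u v) z" by (simp add: G_linear[OF x])
  qed
  show "linear (\<lambda>u. \<Gamma> x u v)" using 1[of v] unfolding christoffel_sym[OF x, of v] by simp
qed

lemma metric_compatible:
  assumes x: "x \<in> S"
  shows "dirder (\<lambda>y. G y v w) x u = G x (\<Gamma> x u v) w + G x v (\<Gamma> x u w)"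
proof -
  have "2 * G x (\<Gamma> x u v) w + 2 * G x (\<Gamma> x u w) v = 2 * dirder (\<lambda>y. G y v w) x u"
    unfolding G_christoffel[OF x] using dirder_G_sym[OF x] by simp
  then show ?thesis using G_sym[OF x, of v] by simp
qed

lemma smooth_christoffel: "smooth_on S (\<lambda>y. \<Gamma> y u v)"
  unfolding christoffel_riesz
proof (rule smooth_on_riesz[OF open_S G smooth_G linear_koszul])
  show "smooth_on S (\<lambda>y. koszul y u v z)" for z
    unfolding koszul_def divide_inverse
    by (intro smooth_on_bounded_linear[OF open_S bounded_linear_mult_left] smooth_on_diff[OF open_S]
        smooth_on_add[OF open_S] smooth_on_dirder smooth_G)
qed

lemma differentiable_christoffel: "x \<in> S \<Longrightarrow> (\<lambda>y. \<Gamma> y u v) differentiable (at x)"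
  using smooth_on_differentiable[OF smooth_christoffel] .

lemmas christoffel_linear =
  linear_add[OF linear_christoffel(1)] linear_add[OF linear_christoffel(2)]
  linear_diff[OF linear_christoffel(1)] linear_diff[OF linear_christoffel(2)]
  linear_neg[OF linear_christoffel(1)] linear_neg[OF linear_christoffel(2)]
  linear_scale[OF linear_christoffel(1)] linear_scale[OF linear_christoffel(2)]
  linear_0[OF linear_christoffel(1)] linear_0[OF linear_christoffel(2)]

abbreviation D\<Gamma> where "D\<Gamma> x u v w \<equiv> dirder (\<lambda>y. \<Gamma> y v w) x u"

lemma linear_D\<Gamma>:
  assumes "x \<in> S"
  shows "linear (\<lambda>u. D\<Gamma> x u v w)" "linear (\<lambda>v. D\<Gamma> x u v w)" "linear (\<lambda>w. D\<Gamma> x u v w)"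
  using assms linear_christoffel differentiable_christoffel
  by (auto intro!: linear_dirder_family[OF open_S] linear_dirder)

lemmas D\<Gamma>_linear =
  linear_add[OF linear_D\<Gamma>(1)] linear_add[OF linear_D\<Gamma>(2)] linear_add[OF linear_D\<Gamma>(3)]
  linear_diff[OF linear_D\<Gamma>(1)] linear_diff[OF linear_D\<Gamma>(2)] linear_diff[OF linear_D\<Gamma>(3)]
  linear_neg[OF linear_D\<Gamma>(1)] linear_neg[OF linear_D\<Gamma>(2)] linear_neg[OF linear_D\<Gamma>(3)]
  linear_scale[OF linear_D\<Gamma>(1)] linear_scale[OF linear_D\<Gamma>(2)] linear_scale[OF linear_D\<Gamma>(3)]

lemma D\<Gamma>_sym: "x \<in> S \<Longrightarrow> D\<Gamma> x u v w = D\<Gamma> x u w v"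
  by (rule fun_cong[OF dirder_cong[OF open_S]]) (auto intro: christoffel_sym)

lemma linear_curvature:
  assumes "x \<in> S"
  shows "linear (\<lambda>u. R x u v w)" "linear (\<lambda>v. R x u v w)" "linear (\<lambda>w. R x u v w)"
  unfolding curvature_def
  by (auto intro!: linearI simp: D\<Gamma>_linear[OF assms] christoffel_linear[OF assms] algebra_simps)

lemma curvature_antisym: "R x v u w = - R x u v w"
  by (simp add: curvature_def)

lemma first_bianchi:
  assumes "x \<in> S"
  shows "R x u v w + R x v w u + R x w u v = 0"
  unfolding curvature_def
  using D\<Gamma>_sym[OF assms] christoffel_sym[OF assms] by (simp add: algebra_simps)

lemma
  assumes x: "x \<in> S" and X: "X differentiable (at x)"
  shows dirder_christoffel_family:
      "dirder (\<lambda>y. \<Gamma> y u (X y)) x h = D\<Gamma> x h u (X x) + \<Gamma> x u (dirder X x h)"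
    and differentiable_christoffel_family: "(\<lambda>y. \<Gamma> y u (X y)) differentiable (at x)"
  using dirder_linear_family[where F = "\<lambda>y. \<Gamma> y u", OF open_S x linear_christoffel(1) differentiable_christoffel[OF x] X]
    differentiable_linear_family[where F = "\<lambda>y. \<Gamma> y u", OF open_S x linear_christoffel(1) differentiable_christoffel[OF x] X]
  by blast+

lemma
  assumes x: "x \<in> S" and X: "X differentiable (at x)" and Y: "Y differentiable (at x)"
  shows differentiable_G_family: "(\<lambda>y. G y (X y) (Y y)) differentiable (at x)"
    and dirder_G_family: "dirder (\<lambda>y. G y (X y) (Y y)) x h
     = G x (dirder X x h + \<Gamma> x h (X x)) (Y x) + G x (X x) (dirder Y x h + \<Gamma> x h (Y x))"
proof -
  have d: "(\<lambda>y. G y u (Y y)) differentiable (at x)" for u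
    by (rule differentiable_linear_family[where F = "\<lambda>y. G y u", OF open_S x linear_G(1) differentiable_G[OF x] Y])
  show "(\<lambda>y. G y (X y) (Y y)) differentiable (at x)"
    by (rule differentiable_linear_family[where F = "\<lambda>y u. G y u (Y y)", OF open_S x linear_G(2) d X])
  have "dirder (\<lambda>y. G y (X y) (Y y)) x h = dirder (\<lambda>y. G y (X x) (Y y)) x h + G x (dirder X x h) (Y x)"
    by (rule dirder_linear_family[where F = "\<lambda>y u. G y u (Y y)", OF open_S x linear_G(2) d X])
  also have "dirder (\<lambda>y. G y (X x) (Y y)) x h = dirder (\<lambda>y. G y (X x) (Y x)) x h + G x (X x) (dirder Y x h)"
    by (rule dirder_linear_family[where F = "\<lambda>y. G y (X x)", OF open_S x linear_G(1) differentiable_G[OF x] Y])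
  finally show "dirder (\<lambda>y. G y (X y) (Y y)) x h
     = G x (dirder X x h + \<Gamma> x h (X x)) (Y x) + G x (X x) (dirder Y x h + \<Gamma> x h (Y x))"
    using x by (simp add: metric_compatible G_linear)
qed

text \<open>Second derivatives of \<open>G y w z\<close> commute; expanding both orders by metric compatibility leaves
  exactly the two curvature terms.\<close>

lemma curvature_skew:
  assumes x: "x \<in> S"
  shows "G x (R x u v w) z = - G x w (R x u v z)"
proof -
  have e: "dirder (\<lambda>y. dirder (\<lambda>y. G y w z) y v) x u
      = G x (D\<Gamma> x u v w + \<Gamma> x u (\<Gamma> x v w)) z + G x (\<Gamma> x v w) (\<Gamma> x u z)
      + G x (\<Gamma> x u w) (\<Gamma> x v z) + G x w (D\<Gamma> x u v z + \<Gamma> x u (\<Gamma> x v z))" for u v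
  proof -
    have "dirder (\<lambda>y. dirder (\<lambda>y. G y w z) y v) x u
        = dirder (\<lambda>y. G y (\<Gamma> y v w) z + G y w (\<Gamma> y v z)) x u"
      by (intro fun_cong[OF dirder_cong[OF open_S x]] metric_compatible)
    also have "\<dots> = dirder (\<lambda>y. G y (\<Gamma> y v w) z) x u + dirder (\<lambda>y. G y w (\<Gamma> y v z)) x u"
      using x differentiable_christoffel differentiable_G_family
      by (intro dirder_eqI[OF has_derivative_add[OF dirder_has_derivative dirder_has_derivative]]) auto
    finally show ?thesis
      using x differentiable_christoffel by (simp add: dirder_G_family)
  qed
  have "dirder (\<lambda>y. dirder (\<lambda>y. G y w z) y v) x u = dirder (\<lambda>y. dirder (\<lambda>y. G y w z) y u) x v"
    by (rule dirder_commute[OF open_S x smooth_G])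
  then show ?thesis
    unfolding e curvature_def by (simp add: G_linear[OF x])
qed

text \<open>The usual octahedron argument from the two antisymmetries and the first Bianchi identity.\<close>

lemma curvature_pair_sym:
  assumes x: "x \<in> S"
  shows "G x (R x u v w) z = G x (R x w z u) v"
proof -
  define K where "K u v w z = G x (R x u v w) z" for u v w z
  have 1: "K v u w z = - K u v w z" for u v w z
    unfolding K_def by (subst curvature_antisym) (simp add: G_linear[OF x])
  have 2: "K u v z w = - K u v w z" for u v w z
    unfolding K_def using curvature_skew[OF x, of u v z w] G_sym[OF x] by simp
  have 3: "K u v w z + K v w u z + K w u v z = 0" for u v w z
    unfolding K_def G_linear(2)[OF x, symmetric] first_bianchi[OF x] by (simp add: G_linear[OF x])
  have "K u v w z = K w z u v"
    using 3[of u v w z] 3[of v w z u] 3[of w z u v] 3[of z u v w]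
      1[of v u w z] 2[of u v w z] 1 2 by (smt (verit))
  then show ?thesis unfolding K_def .
qed

lemma bilinear_ricci: "x \<in> S \<Longrightarrow> bilinear (ricci G x)"
  unfolding bilinear_def ricci_trace
  by (auto intro!: linearI simp: endo_trace_add endo_trace_scaleR linear_add[OF linear_curvature(2)]
     linear_add[OF linear_curvature(3)] linear_scale[OF linear_curvature(2)] linear_scale[OF linear_curvature(3)])

text \<open>Constant vector fields commute, so no bracket terms occur, and the Christoffel terms that make
  \<open>\<nabla>R\<close> out of \<open>\<partial>R\<close> in the arguments \<open>u\<close>, \<open>v\<close> cancel in the cyclic sum since the connection is
  torsion-free. Only the action on the endomorphism part remains.\<close>

lemma second_bianchi:
  assumes x: "x \<in> S"
  shows "(dirder (\<lambda>y. R y u v z) x w + \<Gamma> x w (R x u v z) - R x u v (\<Gamma> x w z))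
    + (dirder (\<lambda>y. R y v w z) x u + \<Gamma> x u (R x v w z) - R x v w (\<Gamma> x u z))
    + (dirder (\<lambda>y. R y w u z) x v + \<Gamma> x v (R x w u z) - R x w u (\<Gamma> x v z)) = 0"
proof -
  let ?D2 = "\<lambda>w u v z. dirder (\<lambda>y. D\<Gamma> y u v z) x w"
  have e: "dirder (\<lambda>y. R y u v z) x w = ?D2 w u v z - ?D2 w v u z
      + (D\<Gamma> x w u (\<Gamma> x v z) + \<Gamma> x u (D\<Gamma> x w v z)) - (D\<Gamma> x w v (\<Gamma> x u z) + \<Gamma> x v (D\<Gamma> x w u z))" for u v w
  proof -
    have d: "(\<lambda>y. D\<Gamma> y a b c) differentiable (at x)" for a b c
      by (rule smooth_on_differentiable[OF smooth_on_dirder[OF smooth_christoffel] x])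
    have dd: "(\<lambda>y. \<Gamma> y a (\<Gamma> y b c)) differentiable (at x)" for a b c
      by (rule differentiable_christoffel_family[OF x differentiable_christoffel[OF x]])
    have "dirder (\<lambda>y. R y u v z) x w = ?D2 w u v z - ?D2 w v u z
        + dirder (\<lambda>y. \<Gamma> y u (\<Gamma> y v z)) x w - dirder (\<lambda>y. \<Gamma> y v (\<Gamma> y u z)) x w"
      unfolding curvature_def
      by (rule dirder_eqI[OF has_derivative_diff[OF has_derivative_add[OF has_derivative_diff]]])
        (rule dirder_has_derivative d dd)+
    then show ?thesis
      by (simp add: dirder_christoffel_family[OF x differentiable_christoffel[OF x]])
  qed
  have "?D2 w u v z = ?D2 u w v z" "?D2 w v u z = ?D2 v w u z" "?D2 u v w z = ?D2 v u w z"
    by (rule dirder_commute[OF open_S x smooth_christoffel])+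
  then show ?thesis
    unfolding e unfolding curvature_def christoffel_linear[OF x]
    by (simp only:) (simp add: algebra_simps)
qed

end

section \<open>Hessians and conformal changes\<close>

text \<open>The coefficient \<open>\<chi>\<close> of the Hessian in the soliton equation on an \<open>n\<close>-dimensional manifold.\<close>

definition hess_coeff :: "nat \<Rightarrow> real \<Rightarrow> real \<Rightarrow> real" where
  "hess_coeff n b s = (real n - 2) / s - b / s\<^sup>2"

lemma hess_coeff_derivative:
  assumes "s \<noteq> 0"
  shows "(hess_coeff n b has_real_derivative (2 * b - (real n - 2) * s) / s^3) (at s)"
proof -
  have sq: "((\<lambda>s::real. s\<^sup>2) has_real_derivative 2 * s) (at s)"
    by (auto intro!: derivative_eq_intros)
  have "((\<lambda>s. (real n - 2) / s - b / s\<^sup>2) has_real_derivative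
      ((0 * s - (real n - 2) * 1) / (s * s) - (0 * s\<^sup>2 - b * (2 * s)) / (s\<^sup>2 * s\<^sup>2))) (at s)"
    using assms by (intro DERIV_diff DERIV_divide sq DERIV_const DERIV_ident) auto
  moreover have "(0 * s - (real n - 2) * 1) / (s * s) - (0 * s\<^sup>2 - b * (2 * s)) / (s\<^sup>2 * s\<^sup>2)
      = (2 * b - (real n - 2) * s) / s^3"
    using assms by (simp add: divide_simps power2_eq_square power3_eq_cube) (simp add: algebra_simps)
  ultimately show ?thesis unfolding hess_coeff_def[abs_def] by simp
qed

locale metric_function = metric_on S G for S :: "'e::euclidean_space set" and G +
  fixes t :: "'e \<Rightarrow> real"
  assumes smooth_t: "smooth_on S t"
begin

abbreviation N where "N \<equiv> grad G t"
abbreviation H where "H \<equiv> hessian G t"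
abbreviation dt where "dt x v \<equiv> dirder t x v"

lemma differentiable_t: "x \<in> S \<Longrightarrow> t differentiable (at x)"
  and differentiable_dt: "x \<in> S \<Longrightarrow> (\<lambda>y. dt y v) differentiable (at x)"
  using smooth_on_differentiable smooth_t smooth_on_dirder by blast+

lemma linear_dt: "x \<in> S \<Longrightarrow> linear (dt x)"
  using linear_dirder differentiable_t by blast

lemmas dt_linear = linear_add[OF linear_dt] linear_diff[OF linear_dt] linear_neg[OF linear_dt]
  linear_scale[OF linear_dt] linear_0[OF linear_dt]

lemma G_grad: "x \<in> S \<Longrightarrow> G x (N x) v = dt x v"
  using riesz[OF G linear_dt, of x x v] by (simp add: grad_def riesz_def)

lemma G_grad_right: "x \<in> S \<Longrightarrow> G x v (N x) = dt x v"
  using G_grad G_sym by metis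

lemma smooth_grad: "smooth_on S N"
  using smooth_on_riesz[OF open_S G smooth_G linear_dt smooth_on_dirder[OF smooth_t]]
  by (simp add: grad_def[abs_def] riesz_def)

lemma differentiable_grad: "x \<in> S \<Longrightarrow> N differentiable (at x)"
  using smooth_on_differentiable[OF smooth_grad] .

definition cov_grad where "cov_grad x u = dirder N x u + \<Gamma> x u (N x)"

text \<open>The Hessian is the covariant derivative of the gradient, lowered by the metric.\<close>

lemma G_cov_grad:
  assumes x: "x \<in> S"
  shows "G x (cov_grad x u) v = H x u v"
proof -
  have "dirder (\<lambda>y. dt y v) x u = dirder (\<lambda>y. G y (N y) v) x u"
    by (intro fun_cong[OF dirder_cong[OF open_S x]]) (simp add: G_grad)
  also have "\<dots> = G x (cov_grad x u) v + G x (N x) (\<Gamma> x u v)"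
    using dirder_G_family[OF x differentiable_grad[OF x] differentiable_const, of v u]
    by (simp add: cov_grad_def)
  finally show ?thesis by (simp add: hessian_def G_grad[OF x])
qed

lemma linear_cov_grad:
  assumes x: "x \<in> S" shows "linear (cov_grad x)"
  unfolding cov_grad_def using linear_dirder[OF differentiable_grad[OF x]] linear_christoffel(2)[OF x]
  by (intro linear_compose_add)

lemma bilinear_hessian:
  assumes x: "x \<in> S" shows "bilinear (H x)"
proof -
  have "H x = (\<lambda>u v. G x (cov_grad x u) v)" using G_cov_grad[OF x] by (simp add: fun_eq_iff)
  then show ?thesis
    by (auto simp: bilinear_def G_linear[OF x] linear_add[OF linear_cov_grad[OF x]]
        linear_scale[OF linear_cov_grad[OF x]] intro!: linearI)
qed

lemma hessian_sym:
  assumes x: "x \<in> S" shows "H x u v = H x v u"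
  unfolding hessian_def
  using dirder_commute[OF open_S x smooth_t] christoffel_sym[OF x, of u v] by simp

lemma smooth_hessian: "smooth_on S (\<lambda>x. H x u v)"
  unfolding hessian_def
  using smooth_on_linear_family[where F = "\<lambda>x. dt x" and X = "\<lambda>x. \<Gamma> x u v",
      OF open_S linear_dt smooth_on_dirder[OF smooth_t] smooth_christoffel]
  by (intro smooth_on_diff[OF open_S] smooth_on_dirder smooth_t)

definition U where "U = {x \<in> S. t x \<noteq> 0}"

lemma open_U: "open U"
proof -
  have "open (t -` (- {0}) \<inter> S)"
    using continuous_on_open_vimage[OF open_S] smooth_on_continuous[OF smooth_t]
    by (metis open_Compl closed_singleton)
  moreover have "t -` (- {0}) \<inter> S = U" unfolding U_def by auto
  ultimately show ?thesis by simp
qed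

lemma U_subset: "x \<in> U \<Longrightarrow> x \<in> S" and U_nz: "x \<in> U \<Longrightarrow> t x \<noteq> 0"
  by (simp_all add: U_def)

abbreviation Gh where "Gh \<equiv> (\<lambda>x u v. G x u v / (t x)\<^sup>2)"

text \<open>The difference tensor of the two Levi-Civita connections, up to the factor \<open>- 1 / t\<close>.\<close>

abbreviation C where "C x u v \<equiv> dt x u *\<^sub>R v + dt x v *\<^sub>R u - G x u v *\<^sub>R N x"

lemma inner_form_conformal: "x \<in> U \<Longrightarrow> inner_form (Gh x)"
  using G[of x] unfolding inner_form_def bilinear_def U_def
  by (auto intro!: linearI simp: linear_add linear_scale add_divide_distrib)

lemma dirder_conformal:
  assumes x: "x \<in> U"
  shows "dirder (\<lambda>y. Gh y u v) x h
     = (inverse (t x))\<^sup>2 * dirder (\<lambda>y. G y u v) x h - 2 * (inverse (t x))^3 * dt x h * G x u v"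
  using x U_subset[OF x] U_nz[OF x]
  by (intro dirder_eqI[THEN trans])
    (rule derivative_eq_intros dirder_has_derivative differentiable_G differentiable_t refl
      | simp add: divide_simps power2_eq_square power3_eq_cube)+

lemma christoffel_conformal:
  assumes x: "x \<in> U"
  shows "christoffel Gh x u v = \<Gamma> x u v - inverse (t x) *\<^sub>R C x u v"
  unfolding christoffel_def[of Gh]
proof (rule the_equality)
  have xS: "x \<in> S" and nz: "t x \<noteq> 0" using U_subset U_nz x by auto
  show *: "\<forall>z. 2 * Gh x (\<Gamma> x u v - inverse (t x) *\<^sub>R C x u v) z
    = dirder (\<lambda>y. Gh y v z) x u + dirder (\<lambda>y. Gh y u z) x v - dirder (\<lambda>y. Gh y u v) x z"
  proof
    fix z
    have "2 * Gh x (\<Gamma> x u v - inverse (t x) *\<^sub>R C x u v) z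
       = (inverse (t x))\<^sup>2 * (2 * G x (\<Gamma> x u v - inverse (t x) *\<^sub>R C x u v) z)"
      by (simp add: divide_inverse power_inverse mult_ac)
    also have "2 * G x (\<Gamma> x u v - inverse (t x) *\<^sub>R C x u v) z
       = 2 * G x (\<Gamma> x u v) z - 2 * inverse (t x) * (dt x u * G x v z + dt x v * G x u z - G x u v * dt x z)"
      by (simp add: G_linear[OF xS] G_grad[OF xS] algebra_simps)
    finally show "2 * Gh x (\<Gamma> x u v - inverse (t x) *\<^sub>R C x u v) z
      = dirder (\<lambda>y. Gh y v z) x u + dirder (\<lambda>y. Gh y u z) x v - dirder (\<lambda>y. Gh y u v) x z"
      unfolding dirder_conformal[OF x] G_christoffel[OF xS]
      by (simp only:) (simp add: algebra_simps power2_eq_square power3_eq_cube)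
  qed
  show "w = \<Gamma> x u v - inverse (t x) *\<^sub>R C x u v"
    if "\<forall>z. 2 * Gh x w z = dirder (\<lambda>y. Gh y v z) x u + dirder (\<lambda>y. Gh y u z) x v - dirder (\<lambda>y. Gh y u v) x z" for w
  proof (rule inner_form_eqI[OF inner_form_conformal[OF x]])
    fix z
    have "2 * Gh x w z = 2 * Gh x (\<Gamma> x u v - inverse (t x) *\<^sub>R C x u v) z"
      using that * by (simp only:)
    then show "Gh x w z = Gh x (\<Gamma> x u v - inverse (t x) *\<^sub>R C x u v) z" by (simp only: mult_cancel_left) simp
  qed
qed

lemma dirder_dt: "dirder (\<lambda>y. dt y v) x u = H x u v + dt x (\<Gamma> x u v)"
  by (simp add: hessian_def)

lemma dirder_grad: "dirder N x u = cov_grad x u - \<Gamma> x u (N x)"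
  by (simp add: cov_grad_def)

text \<open>Partial derivatives are traded for the Hessian, the covariant derivative of the gradient and
  Christoffel symbols, so that the latter can cancel in the curvature.\<close>

lemma dirder_C:
  assumes x: "x \<in> S"
  shows "((\<lambda>y. C y v w) has_derivative (\<lambda>u. (H x u v + dt x (\<Gamma> x u v)) *\<^sub>R w + (H x u w + dt x (\<Gamma> x u w)) *\<^sub>R v
      - ((G x (\<Gamma> x u v) w + G x v (\<Gamma> x u w)) *\<^sub>R N x + G x v w *\<^sub>R (cov_grad x u - \<Gamma> x u (N x))))) (at x)"
proof -
  have "((\<lambda>y. C y v w) has_derivative (\<lambda>u. dirder (\<lambda>y. dt y v) x u *\<^sub>R w + dirder (\<lambda>y. dt y w) x u *\<^sub>R v
      - (G x v w *\<^sub>R dirder N x u + dirder (\<lambda>y. G y v w) x u *\<^sub>R N x))) (at x)"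
    by (intro has_derivative_diff has_derivative_add has_derivative_scaleR has_derivative_scaleR_left
        dirder_has_derivative differentiable_dt differentiable_G differentiable_grad x)
  then show ?thesis
    by (simp add: dirder_dt dirder_grad metric_compatible[OF x] add.commute)
qed

text \<open>Substitution of \<open>\<Gamma> - C / t\<close> into the coordinate expression of the curvature. The
  mixed terms in \<open>\<Gamma>\<close> and \<open>C\<close> cancel by tensoriality, and of the terms quadratic in \<open>C\<close> only those with
  the factor \<open>G(N,N)\<close> survive, the others cancelling against the derivative of the factor \<open>1 / t\<close>.\<close>

lemma curvature_conformal:
  assumes x: "x \<in> U"
  shows "curvature Gh x u v w = R x u v w
     - ((inverse (t x))\<^sup>2 * G x (N x) (N x)) *\<^sub>R (G x v w *\<^sub>R u - G x u w *\<^sub>R v)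
     - inverse (t x) *\<^sub>R (H x u w *\<^sub>R v - H x v w *\<^sub>R u - G x v w *\<^sub>R cov_grad x u + G x u w *\<^sub>R cov_grad x v)"
proof -
  have xS: "x \<in> S" and nz: "t x \<noteq> 0" using U_subset U_nz x by auto
  define q where "q = inverse (t x)"
  have D: "dirder (\<lambda>y. christoffel Gh y v w) x u = D\<Gamma> x u v w + (q\<^sup>2 * dt x u) *\<^sub>R C x v w
     - q *\<^sub>R ((H x u v + dt x (\<Gamma> x u v)) *\<^sub>R w + (H x u w + dt x (\<Gamma> x u w)) *\<^sub>R v
      - ((G x (\<Gamma> x u v) w + G x v (\<Gamma> x u w)) *\<^sub>R N x + G x v w *\<^sub>R (cov_grad x u - \<Gamma> x u (N x))))" for u v
  proof -
    have 1: "((\<lambda>y. inverse (t y)) has_derivative (\<lambda>h. - (inverse (t x) * dt x h * inverse (t x)))) (at x)"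
      by (rule Deriv.has_derivative_inverse[OF nz dirder_has_derivative[OF differentiable_t[OF xS]]])
    have "dirder (\<lambda>y. christoffel Gh y v w) x u = dirder (\<lambda>y. \<Gamma> y v w - inverse (t y) *\<^sub>R C y v w) x u"
      by (intro fun_cong[OF dirder_cong[OF open_U x]] christoffel_conformal)
    also have "\<dots> = D\<Gamma> x u v w - (inverse (t x) *\<^sub>R ((H x u v + dt x (\<Gamma> x u v)) *\<^sub>R w + (H x u w + dt x (\<Gamma> x u w)) *\<^sub>R v
      - ((G x (\<Gamma> x u v) w + G x v (\<Gamma> x u w)) *\<^sub>R N x + G x v w *\<^sub>R (cov_grad x u - \<Gamma> x u (N x))))
       + (- (inverse (t x) * dt x u * inverse (t x))) *\<^sub>R C x v w)"
      by (rule dirder_eqI[OF has_derivative_diff[OF dirder_has_derivative[OF differentiable_christoffel[OF xS]]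
          has_derivative_scaleR[OF 1 dirder_C[OF xS]]]])
    finally show ?thesis by (simp add: q_def power2_eq_square algebra_simps)
  qed
  have e: "christoffel Gh x u v = \<Gamma> x u v - q *\<^sub>R C x u v" for u v
    using christoffel_conformal[OF x] by (simp add: q_def)
  have twice: "(q * (q * (2 * c))) *\<^sub>R z = (q * (q * c)) *\<^sub>R z + (q * (q * c)) *\<^sub>R z" for c and z :: 'e
    by (simp add: scaleR_add_left[symmetric])
  show ?thesis
    unfolding curvature_def[of Gh] D e curvature_def[of G] q_def[symmetric]
    using christoffel_sym[OF xS, of v u] G_sym[OF xS, of v u] hessian_sym[OF xS, of v u]
    by (simp add: christoffel_linear[OF xS] G_linear[OF xS] dt_linear[OF xS] G_grad[OF xS] G_grad_right[OF xS]
        power2_eq_square algebra_simps twice)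
qed

lemma ricci_conformal:
  assumes x: "x \<in> U"
  shows "ricci Gh x v w = ricci G x v w + (real DIM('e) - 2) / t x * H x v w
    + (endo_trace (cov_grad x) / t x - (real DIM('e) - 1) * G x (N x) (N x) / (t x)\<^sup>2) * G x v w"
proof -
  have xS: "x \<in> S" and nz: "t x \<noteq> 0" using U_subset U_nz x by auto
  have lin: "linear (\<lambda>u. G x u w)" "linear (\<lambda>u. H x u w)"
    using bilinear_G[OF xS] bilinear_hessian[OF xS] by (auto simp: bilinear_def)
  have "G x (cov_grad x v) w = H x v w" by (rule G_cov_grad[OF xS])
  then show ?thesis
    unfolding ricci_trace curvature_conformal[OF x]
    by (simp add: endo_trace_add endo_trace_diff endo_trace_scaleR endo_trace_ident endo_trace_rank_one[OF lin(1)] endo_trace_rank_one[OF lin(2)])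
      (simp add: divide_inverse power_inverse algebra_simps)
qed

text \<open>The second derivative of \<open>b / t\<close> contributes \<open>2 b / t\<^sup>3\<close> times \<open>dt \<otimes> dt\<close>, and the change of the
  Christoffel symbols contributes the opposite: the profile \<open>1 / t\<close> is chosen for this
  cancellation.\<close>

lemma hessian_conformal:
  assumes x: "x \<in> U"
  shows "hessian Gh (\<lambda>y. b * inverse (t y)) x u v
    = - b / (t x)\<^sup>2 * H x u v + b * G x (N x) (N x) / (t x)^3 * G x u v"
proof -
  have xS: "x \<in> S" and nz: "t x \<noteq> 0" using U_subset U_nz x by auto
  have d: "((\<lambda>y. b * inverse (t y)) has_derivative (\<lambda>h. b * (- (inverse (t y) * dt y h * inverse (t y))))) (at y)"
    if "y \<in> U" for y
    using that U_subset U_nz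
    by (intro has_derivative_mult_right Deriv.has_derivative_inverse dirder_has_derivative differentiable_t)
  have 1: "dirder (\<lambda>y. b * inverse (t y)) y h = - b * (inverse (t y))\<^sup>2 * dt y h" if "y \<in> U" for y h
    using dirder_eqI[OF d[OF that]] by (simp add: power2_eq_square)
  have inv: "((\<lambda>y. inverse (t y)) has_derivative (\<lambda>h. - (inverse (t x) * dt x h * inverse (t x)))) (at x)"
    by (rule Deriv.has_derivative_inverse[OF nz dirder_has_derivative[OF differentiable_t[OF xS]]])
  have "dirder (\<lambda>y. dirder (\<lambda>y. b * inverse (t y)) y v) x u
      = dirder (\<lambda>y. - b * (inverse (t y) * inverse (t y) * dt y v)) x u"
    by (intro fun_cong[OF dirder_cong[OF open_U x]]) (simp add: 1 power2_eq_square)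
  also have "\<dots> = - b * (inverse (t x) * inverse (t x) * dirder (\<lambda>y. dt y v) x u
     + (inverse (t x) * (- (inverse (t x) * dt x u * inverse (t x)))
         + (- (inverse (t x) * dt x u * inverse (t x))) * inverse (t x)) * dt x v)"
    by (rule dirder_eqI[OF has_derivative_mult_right[OF has_derivative_mult[OF has_derivative_mult[OF inv inv]
        dirder_has_derivative[OF differentiable_dt[OF xS]]]]])
  finally have 2: "dirder (\<lambda>y. dirder (\<lambda>y. b * inverse (t y)) y v) x u = \<dots>" .
  show ?thesis
    unfolding hessian_def[of Gh] 2 1[OF x] christoffel_conformal[OF x] dirder_dt
    by (simp add: dt_linear[OF xS] G_grad[OF xS] divide_inverse power_inverse[symmetric]
        power2_eq_square power3_eq_cube algebra_simps)
qed

lemma soliton_imp_multiple_of_metric: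
  assumes x: "x \<in> U"
    and sol: "\<And>u v. hessian Gh (\<lambda>y. b * inverse (t y)) x u v + ricci Gh x u v = e * Gh x u v"
  obtains s where "\<And>u v. ricci G x u v + hess_coeff DIM('e) b (t x) * H x u v = s * G x u v"
proof
  show "ricci G x u v + hess_coeff DIM('e) b (t x) * H x u v
     = (e / (t x)\<^sup>2 - b * G x (N x) (N x) / (t x)^3
        - (endo_trace (cov_grad x) / t x - (real DIM('e) - 1) * G x (N x) (N x) / (t x)\<^sup>2)) * G x u v" for u v
    using sol[of u v] unfolding hessian_conformal[OF x] ricci_conformal[OF x] hess_coeff_def
    by (simp add: algebra_simps)
qed

end

section \<open>Kaehler metrics\<close>

text \<open>The exterior derivative of a 2-form, evaluated on constant vector fields.\<close>

definition ext_d :: "('e::euclidean_space \<Rightarrow> 'e \<Rightarrow> 'e \<Rightarrow> real) \<Rightarrow> 'e \<Rightarrow> 'e \<Rightarrow> 'e \<Rightarrow> 'e \<Rightarrow> real" where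
  "ext_d \<omega> x u v w =
     dirder (\<lambda>y. \<omega> y u v) x w + dirder (\<lambda>y. \<omega> y v w) x u + dirder (\<lambda>y. \<omega> y w u) x v"

locale kaehler_on = metric_on S G for S :: "'e::euclidean_space set" and G +
  fixes J :: "'e \<Rightarrow> 'e \<Rightarrow> 'e"
  assumes linear_J: "x \<in> S \<Longrightarrow> linear (J x)"
    and smooth_J: "smooth_on S (\<lambda>x. J x v)"
    and J_J: "x \<in> S \<Longrightarrow> J x (J x v) = - v"
    and G_J_J: "x \<in> S \<Longrightarrow> G x (J x u) (J x v) = G x u v"
    and J_parallel: "x \<in> S \<Longrightarrow> covder_endo G J x u v = 0"
begin

lemmas J_linear = linear_add[OF linear_J] linear_diff[OF linear_J] linear_neg[OF linear_J]
  linear_scale[OF linear_J] linear_0[OF linear_J]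

lemma G_J: "x \<in> S \<Longrightarrow> G x u (J x v) = - G x (J x u) v"
  using G_J_J[of x u "J x v"] by (simp add: J_J G_linear)

lemma differentiable_J: "x \<in> S \<Longrightarrow> (\<lambda>y. J y v) differentiable (at x)"
  using smooth_on_differentiable[OF smooth_J] .

lemma dirder_J: "x \<in> S \<Longrightarrow> dirder (\<lambda>y. J y v) x u = J x (\<Gamma> x u v) - \<Gamma> x u (J x v)"
  using J_parallel[of x u v] by (simp add: covder_endo_def algebra_simps)

lemma
  assumes x: "x \<in> S" and X: "X differentiable (at x)"
  shows dirder_J_family: "dirder (\<lambda>y. J y (X y)) x h
      = J x (dirder X x h + \<Gamma> x h (X x)) - \<Gamma> x h (J x (X x))"
    and differentiable_J_family: "(\<lambda>y. J y (X y)) differentiable (at x)"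
  using dirder_linear_family[where F = J, OF open_S x linear_J differentiable_J[OF x] X, of h]
    differentiable_linear_family[where F = J, OF open_S x linear_J differentiable_J[OF x] X]
  by (simp_all add: dirder_J[OF x] J_linear[OF x])

text \<open>The Ricci identity for the parallel field \<open>J\<close>: commuting second derivatives of \<open>J\<close> say that the
  curvature commutes with it.\<close>

lemma curvature_J:
  assumes x: "x \<in> S"
  shows "R x u v (J x w) = J x (R x u v w)"
proof -
  note d\<Gamma> = differentiable_christoffel[OF x]
  have e: "dirder (\<lambda>y. dirder (\<lambda>y. J y w) y v) x u
    = J x (D\<Gamma> x u v w + \<Gamma> x u (\<Gamma> x v w)) - \<Gamma> x u (J x (\<Gamma> x v w))
      - (D\<Gamma> x u v (J x w) + \<Gamma> x v (J x (\<Gamma> x u w) - \<Gamma> x u (J x w)))" for u v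
  proof -
    have "dirder (\<lambda>y. dirder (\<lambda>y. J y w) y v) x u = dirder (\<lambda>y. J y (\<Gamma> y v w) - \<Gamma> y v (J y w)) x u"
      by (intro fun_cong[OF dirder_cong[OF open_S x]] dirder_J)
    also have "\<dots> = dirder (\<lambda>y. J y (\<Gamma> y v w)) x u - dirder (\<lambda>y. \<Gamma> y v (J y w)) x u"
      by (rule dirder_eqI[OF has_derivative_diff])
        (rule dirder_has_derivative differentiable_J_family[OF x d\<Gamma>]
          differentiable_christoffel_family[OF x differentiable_J[OF x]])+
    finally show ?thesis
      by (simp only: dirder_J_family[OF x d\<Gamma>] dirder_J[OF x]
          dirder_christoffel_family[OF x differentiable_J[OF x]])
  qed
  have "dirder (\<lambda>y. dirder (\<lambda>y. J y w) y v) x u = dirder (\<lambda>y. dirder (\<lambda>y. J y w) y u) x v"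
    by (rule dirder_commute[OF open_S x smooth_J])
  then show ?thesis
    unfolding e curvature_def by (simp add: J_linear[OF x] christoffel_linear[OF x] algebra_simps)
qed

text \<open>By pair symmetry, commuting with \<open>J\<close> is the same as invariance in the first two arguments.\<close>

lemma curvature_J_J:
  assumes x: "x \<in> S"
  shows "R x (J x u) (J x v) w = R x u v w"
proof (rule inner_form_eqI[OF G[OF x]])
  fix z
  have "G x (R x (J x u) (J x v) w) z = G x (R x w z (J x u)) (J x v)"
    by (rule curvature_pair_sym[OF x])
  also have "\<dots> = G x (R x w z u) v" by (simp add: curvature_J[OF x] G_J_J[OF x])
  also have "\<dots> = G x (R x u v w) z" by (rule curvature_pair_sym[OF x, symmetric])
  finally show "G x (R x (J x u) (J x v) w) z = G x (R x u v w) z" .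
qed

lemma ricci_J_J:
  assumes x: "x \<in> S"
  shows "ricci G x (J x v) (J x w) = ricci G x v w"
  unfolding ricci_trace
  using endo_trace_comp_commute[OF linear_J[OF x] linear_curvature(1)[OF x, of "J x v" w]]
  by (simp add: curvature_J[OF x] curvature_J_J[OF x])

text \<open>Defined through the trace of \<open>J \<circ> R(u,v)\<close> rather than as \<open>r(Ju,v)\<close>, since in this form the
  second Bianchi identity applies directly.\<close>

definition ricci_form where "ricci_form x u v = endo_trace (\<lambda>z. J x (R x u v z)) / 2"

text \<open>By the first Bianchi identity \<open>R(u,v)\<close> is a difference of two endomorphisms whose traces against
  \<open>J\<close> are Ricci curvatures; symmetry and \<open>J\<close>-invariance of the Ricci tensor make these
  two contributions equal.\<close>

lemma ricci_form_eq:
  assumes x: "x \<in> S" and sym: "\<And>u v. ricci G x u v = ricci G x v u"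
  shows "ricci_form x u v = ricci G x (J x u) v"
proof -
  have "J x (R x u v z) = R x z v (J x u) - R x z u (J x v)" for z
  proof -
    have "R x u v z = R x z v u - R x z u v"
      using first_bianchi[OF x, of u v z] curvature_antisym[of x v z u]
      by (simp add: eq_neg_iff_add_eq_0 algebra_simps)
    then show ?thesis by (simp add: J_linear[OF x] curvature_J[OF x])
  qed
  then have "2 * ricci_form x u v = ricci G x v (J x u) - ricci G x u (J x v)"
    by (simp add: ricci_form_def ricci_trace endo_trace_diff)
  also have "ricci G x u (J x v) = - ricci G x (J x u) v"
    using ricci_J_J[OF x, of u "J x v"] bilinear_rneg[OF bilinear_ricci[OF x]] by (simp add: J_J[OF x])
  finally show ?thesis using sym[of v] by simp
qed

lemma smooth_curvature: "smooth_on S (\<lambda>x. R x u v w)"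
  unfolding curvature_def
  by (intro smooth_on_diff[OF open_S] smooth_on_add[OF open_S] smooth_on_dirder smooth_christoffel
      smooth_on_linear_family[where F = "\<lambda>y. \<Gamma> y _", OF open_S linear_christoffel(1)])

lemma smooth_ricci: "smooth_on S (\<lambda>x. ricci G x v w)"
  unfolding ricci_def
  by (intro smooth_on_sum[OF open_S] smooth_on_bounded_linear[OF open_S bounded_linear_inner_left] smooth_curvature)

text \<open>Because \<open>J\<close> is parallel, the trace may be differentiated covariantly: the commutator terms needed
  for this cancel under the trace.\<close>

lemma ricci_form_has_derivative:
  assumes x: "x \<in> S"
  shows "((\<lambda>y. ricci_form y u v) has_derivative (\<lambda>w. endo_trace (\<lambda>z. J x
      (dirder (\<lambda>y. R y u v z) x w + \<Gamma> x w (R x u v z) - R x u v (\<Gamma> x w z))) / 2)) (at x)"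
proof -
  note dR = smooth_on_differentiable[OF smooth_curvature x]
  have "((\<lambda>y. ricci_form y u v) has_derivative
      (\<lambda>w. endo_trace (\<lambda>z. dirder (\<lambda>y. J y (R y u v z)) x w) / 2)) (at x)"
    unfolding ricci_form_def endo_trace_def divide_inverse
    by (intro has_derivative_mult_left has_derivative_sum has_derivative_inner_left
        dirder_has_derivative differentiable_J_family[OF x dR])
  moreover have "endo_trace (\<lambda>z. dirder (\<lambda>y. J y (R y u v z)) x w)
     = endo_trace (\<lambda>z. J x (dirder (\<lambda>y. R y u v z) x w + \<Gamma> x w (R x u v z) - R x u v (\<Gamma> x w z)))" for w
    using endo_trace_comp_commute[OF linear_christoffel(1)[OF x, of w]
        linear_compose[OF linear_curvature(3)[OF x, of u v] linear_J[OF x]]]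
    by (simp add: dirder_J_family[OF x dR] endo_trace_diff endo_trace_add J_linear[OF x])
  ultimately show ?thesis by simp
qed

lemma ricci_form_closed:
  assumes x: "x \<in> S"
  shows "ext_d ricci_form x u v w = 0"
proof -
  have "ext_d ricci_form x u v w = endo_trace (\<lambda>z. J x
     ((dirder (\<lambda>y. R y u v z) x w + \<Gamma> x w (R x u v z) - R x u v (\<Gamma> x w z))
    + (dirder (\<lambda>y. R y v w z) x u + \<Gamma> x u (R x v w z) - R x v w (\<Gamma> x u z))
    + (dirder (\<lambda>y. R y w u z) x v + \<Gamma> x v (R x w u z) - R x w u (\<Gamma> x v z)))) / 2"
    unfolding ext_d_def dirder_eqI[OF ricci_form_has_derivative[OF x]] linear_add[OF linear_J[OF x]] endo_trace_add
    by (simp add: add_divide_distrib)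
  also have "\<dots> = 0"
    unfolding second_bianchi[OF x] by (simp add: J_linear[OF x] endo_trace_def)
  finally show ?thesis .
qed

definition kaehler_form where "kaehler_form x u v = G x (J x u) v"

lemma kaehler_form_differentiable: "x \<in> S \<Longrightarrow> (\<lambda>y. kaehler_form y u v) differentiable (at x)"
  unfolding kaehler_form_def by (intro differentiable_G_family differentiable_J differentiable_const)

lemma kaehler_form_closed:
  assumes x: "x \<in> S"
  shows "ext_d kaehler_form x u v w = 0"
proof -
  have e: "dirder (\<lambda>y. kaehler_form y u v) x w = G x (J x (\<Gamma> x w u)) v - G x (J x (\<Gamma> x w v)) u" for u v w
    unfolding kaehler_form_def
    using dirder_G_family[OF x differentiable_J[OF x] differentiable_const, of u v w]
      G_J[OF x, of "\<Gamma> x w v" u] G_sym[OF x]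
    by (simp add: dirder_J[OF x])
  show ?thesis
    unfolding ext_d_def e using christoffel_sym[OF x] by simp
qed

end

locale kaehler_function = kaehler_on S G J + metric_function S G t
  for S :: "'e::euclidean_space set" and G J t
begin

definition hessian_form where "hessian_form x u v = H x (J x u) v"

lemma hessian_form_differentiable:
  assumes "x \<in> S" shows "(\<lambda>y. hessian_form y u v) differentiable (at x)"
  unfolding hessian_form_def
  by (rule differentiable_linear_family[where F = "\<lambda>y w. H y w v", OF open_S assms _
        smooth_on_differentiable[OF smooth_hessian assms] differentiable_J[OF assms]])
    (use bilinear_hessian in \<open>simp add: bilinear_def\<close>)

text \<open>For a \<open>J\<close>-invariant Hessian the form is \<open>- 1 / 2\<close> times the differential of the 1-form \<open>\<theta>\<close> that
  sends \<open>v\<close> to \<open>dt (J v)\<close>, and second derivatives commute.\<close>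

lemma hessian_form_closed:
  assumes x: "x \<in> S" and inv: "\<And>y u v. y \<in> S \<Longrightarrow> H y (J y u) (J y v) = H y u v"
  shows "ext_d hessian_form x u v w = 0"
proof -
  define \<theta> where "\<theta> v y = dt y (J y v)" for v y
  have smooth_\<theta>: "smooth_on S (\<theta> v)" for v
    unfolding \<theta>_def
    by (rule smooth_on_linear_family[OF open_S linear_dt smooth_on_dirder[OF smooth_t] smooth_J])
  have d\<theta>: "dirder (\<theta> v) y u = H y u (J y v) + dt y (J y (\<Gamma> y u v))" if y: "y \<in> S" for y u v
    using dirder_linear_family[where F = "\<lambda>y. dt y", OF open_S y linear_dt differentiable_dt[OF y] differentiable_J[OF y], of v u]
    by (simp add: \<theta>_def[abs_def] dirder_dt dirder_J[OF y] dt_linear[OF y])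
  have form: "-2 * hessian_form y u v = dirder (\<theta> v) y u - dirder (\<theta> u) y v" if y: "y \<in> S" for y u v
    using inv[OF y, of u "J y v"] bilinear_rneg[OF bilinear_hessian[OF y]] hessian_sym[OF y, of v "J y u"]
      christoffel_sym[OF y, of u v]
    by (simp add: d\<theta>[OF y] hessian_form_def J_J[OF y])
  have e: "-2 * dirder (\<lambda>y. hessian_form y u v) x w
     = dirder (\<lambda>y. dirder (\<theta> v) y u) x w - dirder (\<lambda>y. dirder (\<theta> u) y v) x w" for u v w
  proof -
    have "-2 * dirder (\<lambda>y. hessian_form y u v) x w = dirder (\<lambda>y. -2 * hessian_form y u v) x w"
      by (rule dirder_eqI[OF has_derivative_mult_right, symmetric])
        (rule dirder_has_derivative hessian_form_differentiable[OF x])+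
    also have "\<dots> = dirder (\<lambda>y. dirder (\<theta> v) y u - dirder (\<theta> u) y v) x w"
      by (rule fun_cong[OF dirder_cong[OF open_S x form]])
    also have "\<dots> = dirder (\<lambda>y. dirder (\<theta> v) y u) x w - dirder (\<lambda>y. dirder (\<theta> u) y v) x w"
      by (rule dirder_eqI[OF has_derivative_diff])
        (rule dirder_has_derivative smooth_on_differentiable[OF smooth_on_dirder[OF smooth_\<theta>] x])+
    finally show ?thesis .
  qed
  have "-2 * ext_d hessian_form x u v w = 0"
    unfolding ext_d_def distrib_left e
    using dirder_commute[OF open_S x smooth_\<theta>, of v u w] dirder_commute[OF open_S x smooth_\<theta>, of u v w]
      dirder_commute[OF open_S x smooth_\<theta>, of w u v] by linarith
  then show ?thesis by simp
qed

text \<open>The covariant derivative of \<open>J\<nabla>t\<close> is \<open>J\<close> applied to that of \<open>\<nabla>t\<close>, so its symmetric part measures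
  the failure of the Hessian to be \<open>J\<close>-invariant.\<close>

lemma lie_metric_J_grad:
  assumes x: "x \<in> S" and inv: "\<And>u v. H x (J x u) (J x v) = H x u v"
  shows "lie_metric (\<lambda>y. J y (N y)) G x u v = 0"
proof -
  have DX: "dirder (\<lambda>y. J y (N y)) x u = J x (cov_grad x u) - \<Gamma> x (J x (N x)) u" for u
    using dirder_J_family[OF x differentiable_grad[OF x], of u] christoffel_sym[OF x]
    by (simp add: cov_grad_def)
  have GJ: "G x (J x (cov_grad x u)) v = - H x u (J x v)" for u v
    using G_J[OF x, of "cov_grad x u" v] by (simp add: G_cov_grad[OF x])
  have "lie_metric (\<lambda>y. J y (N y)) G x u v = G x (J x (cov_grad x u)) v + G x u (J x (cov_grad x v))"
    unfolding lie_metric_def DX metric_compatible[OF x] by (simp add: G_linear[OF x])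
  also have "\<dots> = - H x u (J x v) - H x v (J x u)"
    unfolding G_sym[OF x, of u] by (simp add: GJ)
  also have "H x u (J x v) = - H x v (J x u)"
    using inv[of u "J x v"] hessian_sym[OF x, of v] bilinear_rneg[OF bilinear_hessian[OF x]]
    by (simp add: J_J[OF x])
  finally show ?thesis by simp
qed

end

section \<open>Conformal solitons in a chart\<close>

locale conformal_soliton = kaehler_function S G J t
  for S :: "'e::euclidean_space set" and G J t +
  fixes b e :: real
  assumes soliton: "x \<in> S \<Longrightarrow> t x \<noteq> 0 \<Longrightarrow>
      hessian Gh (\<lambda>y. b * inverse (t y)) x u v + ricci Gh x u v = e * Gh x u v"
    and dim: "DIM('e) \<ge> 6"
begin

lemma continuous_t: "continuous_on S t"
  using smooth_on_continuous[OF smooth_t] .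

lemma soliton_equation:
  assumes x: "x \<in> U"
  obtains s where "\<And>u v. ricci G x u v + hess_coeff DIM('e) b (t x) * H x u v = s * G x u v"
  by (rule soliton_imp_multiple_of_metric[OF x soliton[OF U_subset[OF x] U_nz[OF x]]]) (rule that)

text \<open>Off the values \<open>0\<close> and \<open>b / (n - 2)\<close> of \<open>t\<close>, where \<open>\<chi>\<close> is defined and nonzero, the soliton equation
  expresses the Hessian by the \<open>J\<close>-invariant tensors \<open>r\<close> and \<open>G\<close>; on an open set where \<open>t\<close> is constant
  the Hessian vanishes.\<close>

lemma hessian_J_J:
  assumes x: "x \<in> S"
  shows "H x (J x u) (J x v) = H x u v"
proof -
  define f where "f y = H y (J y u) (J y v) - H y u v" for y
  have "f x = 0"
  proof (rule zero_by_density[OF open_S x continuous_t, of _ "{0, b / (real DIM('e) - 2)}"])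
    show "continuous_on S f"
      unfolding f_def
      by (intro smooth_on_continuous smooth_on_diff[OF open_S] smooth_hessian
          smooth_on_bilinear_family[OF open_S bilinear_hessian] smooth_J)
    show "f y = 0" if y: "y \<in> S" and "t y \<notin> {0, b / (real DIM('e) - 2)}" for y
    proof -
      have nz: "t y \<noteq> 0" and "t y * (real DIM('e) - 2) \<noteq> b" using that dim by (auto simp: field_simps)
      then have "hess_coeff DIM('e) b (t y) \<noteq> 0"
      proof -
        have "hess_coeff DIM('e) b (t y) = (t y * (real DIM('e) - 2) - b) / (t y)\<^sup>2"
          using nz by (simp add: hess_coeff_def power2_eq_square diff_divide_distrib)
        then show ?thesis using nz \<open>t y * (real DIM('e) - 2) \<noteq> b\<close> by simp
      qed
      moreover obtain s where s: "\<And>u v. ricci G y u v + hess_coeff DIM('e) b (t y) * H y u v = s * G y u v"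
        using soliton_equation y nz by (auto simp: U_def)
      have "hess_coeff DIM('e) b (t y) * f y = 0"
        using s[of u v] s[of "J y u" "J y v"]
        unfolding f_def right_diff_distrib ricci_J_J[OF y] G_J_J[OF y] by linarith
      ultimately show ?thesis by simp
    qed
    show "f x = 0" if T: "open T" "x \<in> T" "T \<subseteq> S" and c: "\<And>y. y \<in> T \<Longrightarrow> t y = c" for T c
    proof -
      have dt0: "dt y w = 0" if "y \<in> T" for y w
        using dirder_cong[OF T(1) that c] by (simp add: frechet_derivative_const)
      have "H x u v = 0" for u v
        unfolding hessian_def using dirder_cong[OF T(1,2) dt0] dt0[OF T(2)] by (simp add: frechet_derivative_const)
      then show ?thesis by (simp add: f_def)
    qed
  qed simp
  then show ?thesis by (simp add: f_def)
qed

text \<open>The soliton equation expresses the Ricci tensor by two symmetric forms.\<close>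

lemma ricci_sym_U: "x \<in> U \<Longrightarrow> ricci G x u v = ricci G x v u"
proof -
  assume x: "x \<in> U"
  obtain s where s: "\<And>u v. ricci G x u v + hess_coeff DIM('e) b (t x) * H x u v = s * G x u v"
    using soliton_equation[OF x] by blast
  show ?thesis using s[of u v] s[of v u] hessian_sym[OF U_subset[OF x], of u v] G_sym[OF U_subset[OF x], of u v]
    by simp
qed

text \<open>The exterior derivative of \<open>\<rho> + \<chi> \<alpha> = \<sigma> \<omega>\<close>, in which the derivatives of the closed
  forms drop out; \<open>a\<close> is \<open>d\<sigma>\<close>, and the factor in front is \<open>\<chi>'\<close>.\<close>

lemma differentiated_equation:
  assumes x: "x \<in> U"
  obtains a where "\<And>u v w. (2 * b - (real DIM('e) - 2) * t x) / (t x)^3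
        * (dt x w * hessian_form x u v + dt x u * hessian_form x v w + dt x v * hessian_form x w u)
       = a w * kaehler_form x u v + a u * kaehler_form x v w + a v * kaehler_form x w u"
proof -
  have xS: "x \<in> S" using U_subset[OF x] .
  define k where "k = (2 * b - (real DIM('e) - 2) * t x) / (t x)^3"
  \<comment> \<open>Evaluating on a fixed vector exhibits \<open>\<sigma>\<close> (here \<open>s\<close>) as a differentiable function.\<close>
  obtain u0 :: 'e where u0: "u0 \<noteq> 0" by (metis nonempty_Basis all_not_in_conv nonzero_Basis)
  have G0: "G y u0 u0 \<noteq> 0" if "y \<in> S" for y
    using G[OF that] u0 unfolding inner_form_def by force
  define s where "s y = (ricci G y u0 u0 + hess_coeff DIM('e) b (t y) * H y u0 u0) / G y u0 u0" for y
  have eq: "ricci_form y u v + hess_coeff DIM('e) b (t y) * hessian_form y u v - s y * kaehler_form y u v = 0"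
    if y: "y \<in> U" for y u v
  proof -
    obtain c where c: "\<And>u v. ricci G y u v + hess_coeff DIM('e) b (t y) * H y u v = c * G y u v"
      using soliton_equation[OF y] by blast
    then have "s y = c" using G0[OF U_subset[OF y]] by (simp add: s_def)
    then show ?thesis
      using c by (simp add: ricci_form_eq[OF U_subset[OF y] ricci_sym_U[OF y]] hessian_form_def kaehler_form_def)
  qed
  have dhc: "((\<lambda>y. hess_coeff DIM('e) b (t y)) has_derivative (\<lambda>h. k * dt x h)) (at x)"
    using has_derivative_compose[OF dirder_has_derivative[OF differentiable_t[OF xS]]
        hess_coeff_derivative[OF U_nz[OF x], of "DIM('e)" b, unfolded has_field_derivative_def]]
    by (simp add: k_def)
  have "s differentiable (at x)"
    unfolding s_def
    using smooth_on_differentiable[OF smooth_ricci xS] smooth_on_differentiable[OF smooth_hessian xS]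
      differentiable_G[OF xS] G0[OF xS] differentiableI[OF dhc]
    by (intro differentiable_divide differentiable_add differentiable_mult)
  then have ds: "(s has_derivative dirder s x) (at x)" by (rule dirder_has_derivative)
  have D: "dirder (\<lambda>y. ricci_form y u v) x w
      + (hess_coeff DIM('e) b (t x) * dirder (\<lambda>y. hessian_form y u v) x w + k * dt x w * hessian_form x u v)
      - (s x * dirder (\<lambda>y. kaehler_form y u v) x w + dirder s x w * kaehler_form x u v) = 0" for u v w
  proof -
    have "((\<lambda>y. ricci_form y u v + hess_coeff DIM('e) b (t y) * hessian_form y u v - s y * kaehler_form y u v) has_derivative
       (\<lambda>w. dirder (\<lambda>y. ricci_form y u v) x w
      + (hess_coeff DIM('e) b (t x) * dirder (\<lambda>y. hessian_form y u v) x w + k * dt x w * hessian_form x u v)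
      - (s x * dirder (\<lambda>y. kaehler_form y u v) x w + dirder s x w * kaehler_form x u v))) (at x)"
      by (intro has_derivative_diff has_derivative_add has_derivative_mult dhc ds dirder_has_derivative
         differentiableI[OF ricci_form_has_derivative[OF xS]] hessian_form_differentiable[OF xS]
         kaehler_form_differentiable[OF xS])
    from dirder_eqI[OF this, of w] show ?thesis
      using dirder_cong[OF open_U x eq] by (simp add: frechet_derivative_const)
  qed
  show ?thesis
  proof
    fix u v w
    have "ext_d ricci_form x u v w + hess_coeff DIM('e) b (t x) * ext_d hessian_form x u v w - s x * ext_d kaehler_form x u v w
       + k * (dt x w * hessian_form x u v + dt x u * hessian_form x v w + dt x v * hessian_form x w u)
       - (dirder s x w * kaehler_form x u v + dirder s x u * kaehler_form x v w + dirder s x v * kaehler_form x w u) = 0"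
      using D[of u v w] D[of v w u] D[of w u v] unfolding ext_d_def by (simp add: algebra_simps)
    then show "(2 * b - (real DIM('e) - 2) * t x) / (t x)^3
        * (dt x w * hessian_form x u v + dt x u * hessian_form x v w + dt x v * hessian_form x w u)
       = dirder s x w * kaehler_form x u v + dirder s x u * kaehler_form x v w + dirder s x v * kaehler_form x w u"
      by (simp add: ricci_form_closed[OF xS] hessian_form_closed[OF xS hessian_J_J] kaehler_form_closed[OF xS]
         flip: k_def)
  qed
qed

lemma orthogonal_vector_exists:
  assumes x: "x \<in> S" and F: "finite F" "card F < DIM('e)"
  obtains z where "z \<noteq> 0" "\<And>v. v \<in> F \<Longrightarrow> G x v z = 0"
proof -
  define L where "L v = (\<Sum>i\<in>Basis. G x v i *\<^sub>R i)" for v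
  have "dim (L ` F) \<le> card (L ` F)" using F(1) by (intro dim_le_card') simp
  also have "\<dots> \<le> card F" by (rule card_image_le[OF F(1)])
  finally have "dim (L ` F) < DIM('e)" using F(2) by simp
  then obtain z where z: "z \<noteq> 0" "\<And>y. y \<in> span (L ` F) \<Longrightarrow> orthogonal z y"
    by (rule orthogonal_to_subspace_exists) (rule that)
  show ?thesis
  proof
    show "G x v z = 0" if "v \<in> F" for v
      using z(2)[of "L v"] that linear_functional_inner[OF linear_G(1)[OF x], of v z]
      by (simp add: L_def orthogonal_def span_base inner_commute)
  qed (rule z(1))
qed

text \<open>The algebraic core: what \<open>\<chi>' dt \<and> \<alpha> = a \<and> \<omega>\<close> implies at one point with \<open>dt \<noteq> 0\<close> and \<open>\<chi>' \<noteq> 0\<close>.\<close>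

lemma hessian_eigenvector_generic:
  assumes x: "x \<in> U" and dt: "N x \<noteq> 0" and k: "2 * b - (real DIM('e) - 2) * t x \<noteq> 0"
    and v: "G x v (N x) = 0" "G x v (J x (N x)) = 0"
  shows "\<exists>l. \<forall>w. H x v w = l * G x v w"
proof -
  have xS: "x \<in> S" using U_subset[OF x] .
  define k where "k = (2 * b - (real DIM('e) - 2) * t x) / (t x)^3"
  have k0: "k \<noteq> 0" using k U_nz[OF x] by (simp add: k_def)
  define Q where "Q = dt x (N x)"
  have Q0: "Q > 0" using G[OF xS] dt G_grad[OF xS] unfolding Q_def inner_form_def by metis
  obtain a where eq: "\<And>u v w. k
        * (dt x w * hessian_form x u v + dt x u * hessian_form x v w + dt x v * hessian_form x w u)
       = a w * kaehler_form x u v + a u * kaehler_form x v w + a v * kaehler_form x w u"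
    using differentiated_equation[OF x] unfolding k_def by blast
  \<comment> \<open>\<open>d\<sigma>\<close> vanishes on the kernel of \<open>dt\<close>: evaluate on \<open>u, z, Jz\<close> with \<open>z\<close> orthogonal to \<open>u\<close>, \<open>\<nabla>t\<close>
    and their images under \<open>J\<close>, where only \<open>d\<sigma>(u) \<omega>(z, Jz)\<close> can survive. Such a \<open>z\<close>
    satisfies four linear conditions, hence the need for more than four dimensions.\<close>
  have a0: "a u = 0" if u: "dt x u = 0" for u
  proof -
    have "card {u, J x u, N x, J x (N x)} \<le> 4"
      by (intro order_trans[OF card_insert_le_m1] card_insert_le_m1; simp)
    then obtain z where z: "z \<noteq> 0" "\<And>v. v \<in> {u, J x u, N x, J x (N x)} \<Longrightarrow> G x v z = 0"
      using orthogonal_vector_exists[OF xS, of "{u, J x u, N x, J x (N x)}"] dim by auto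
    have "G x u z = 0" "G x (J x u) z = 0" "G x (N x) z = 0" "G x (J x (N x)) z = 0"
      using z(2) by auto
    then have "dt x z = 0" "dt x (J x z) = 0" "kaehler_form x u z = 0" "kaehler_form x (J x z) u = 0"
      "kaehler_form x z (J x z) = G x z z"
      using G_J[OF xS, of "N x" z] G_J_J[OF xS] G_sym[OF xS, of z u]
      by (simp_all add: kaehler_form_def J_J[OF xS] G_linear[OF xS] flip: G_grad[OF xS])
    then have "a u * G x z z = 0" using eq[of "J x z" u z] u by simp
    moreover have "G x z z > 0" using G[OF xS] z(1) unfolding inner_form_def by blast
    ultimately show ?thesis by simp
  qed
  \<comment> \<open>Evaluation on \<open>-Jv, w, \<nabla>t\<close>, where only the terms with \<open>dt(\<nabla>t)\<close> and \<open>d\<sigma>(\<nabla>t)\<close> survive.\<close>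
  have main: "k * Q * H x v w = a (N x) * G x v w" if v: "G x v (J x (N x)) = 0" and w: "dt x w = 0" for v w
  proof -
    have "dt x (J x v) = 0"
      using G_J[OF xS, of v "N x"] v by (simp add: G_grad_right[OF xS])
    then have "k * (Q * hessian_form x (- J x v) w) = a (N x) * kaehler_form x (- J x v) w"
      using eq[of "- J x v" w "N x"] w a0[OF w] a0[of "- J x v"]
      by (simp add: Q_def dt_linear[OF xS])
    then show ?thesis
      by (simp add: hessian_form_def kaehler_form_def J_linear[OF xS] J_J[OF xS])
  qed
  \<comment> \<open>The remaining direction \<open>w = \<nabla>t\<close> is rotated by \<open>J\<close> into the kernel of \<open>dt\<close>.\<close>
  have "k * Q * H x v (N x) = k * Q * H x (J x v) (J x (N x))" by (simp add: hessian_J_J[OF xS])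
  also have "\<dots> = a (N x) * G x (J x v) (J x (N x))"
  proof (rule main)
    show "G x (J x v) (J x (N x)) = 0" using v by (simp add: G_J_J[OF xS])
    show "dt x (J x (N x)) = 0"
      using G_J[OF xS, of "N x" "N x"] G_sym[OF xS, of "N x" "J x (N x)"] by (simp add: G_grad_right[OF xS])
  qed
  also have "\<dots> = 0" using v by (simp add: G_J_J[OF xS])
  finally have HN: "H x v (N x) = 0" using k0 Q0 by simp
  show ?thesis
  proof (intro exI allI)
    fix w
    define w0 where "w0 = w - (dt x w / Q) *\<^sub>R N x"
    have "dt x w0 = 0" using Q0 by (simp add: w0_def dt_linear[OF xS] flip: Q_def)
    from main[OF v(2) this] have "H x v w0 = a (N x) / (k * Q) * G x v w0"
      using k0 Q0 by (simp add: field_simps)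
    moreover have "H x v w0 = H x v w" "G x v w0 = G x v w"
      using HN v(1) bilinear_rsub[OF bilinear_hessian[OF xS]] bilinear_rmul[OF bilinear_hessian[OF xS]]
      by (simp_all add: w0_def G_linear[OF xS])
    ultimately show "H x v w = a (N x) / (k * Q) * G x v w" by simp
  qed
qed

text \<open>The orthogonal projection of \<open>v\<close> to the complement of \<open>\<nabla>t\<close> and \<open>J\<nabla>t\<close>, multiplied by the square of
  the length of the gradient so that it stays smooth where the gradient vanishes.\<close>

definition hor where
  "hor v y = dt y (N y) *\<^sub>R v - G y v (N y) *\<^sub>R N y - G y v (J y (N y)) *\<^sub>R J y (N y)"

lemma smooth_J_grad: "smooth_on S (\<lambda>y. J y (N y))"
  by (rule smooth_on_linear_family[where F = J, OF open_S linear_J smooth_J smooth_grad])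

lemma smooth_hor: "smooth_on S (hor v)"
proof -
  have sG: "smooth_on S (\<lambda>y. G y v (X y))" if "smooth_on S X" for X
    by (rule smooth_on_linear_family[where F = "\<lambda>y. G y v", OF open_S linear_G(1) smooth_G that])
  have "smooth_on S (\<lambda>y. dt y (N y))"
    by (rule smooth_on_linear_family[where F = "\<lambda>y. dt y", OF open_S linear_dt smooth_on_dirder[OF smooth_t] smooth_grad])
  then show ?thesis
    unfolding hor_def[abs_def]
    by (intro smooth_on_diff[OF open_S] smooth_on_scaleR[OF open_S] sG smooth_grad smooth_J_grad smooth_on_const)
qed

lemma G_J_grad:
  assumes x: "x \<in> S"
  shows "G x (J x (N x)) (N x) = 0" "G x (N x) (J x (N x)) = 0"
  using G_J[OF x, of "N x" "N x"] G_sym[OF x, of "N x" "J x (N x)"] by auto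

lemma hor_orthogonal:
  assumes x: "x \<in> S"
  shows "G x (hor v x) (N x) = 0" "G x (hor v x) (J x (N x)) = 0"
  using G_J_grad[OF x] G_J_J[OF x, of "N x" "N x"]
  by (simp_all add: hor_def G_linear[OF x] dt_linear[OF x] G_grad_right[OF x])

text \<open>For vectors \<open>h\<close> that depend continuously on the point, being an eigenvector implies the polynomial
  identity \<open>B(h,w) G(h,h) = B(h,h) G(h,w)\<close>, a closed condition, from which the eigenvalue can be
  recovered when \<open>h \<noteq> 0\<close>. It therefore spreads from the generic points to all points with
  \<open>dt \<noteq> 0\<close>. Where the gradient vanishes, \<open>hor v\<close> does too, and the identity is trivial.\<close>

lemma eigenvector_by_density:
  assumes bil: "\<And>y. y \<in> S \<Longrightarrow> bilinear (B y)" and smooth: "\<And>u v. smooth_on S (\<lambda>y. B y u v)"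
    and generic: "\<And>y z. y \<in> U \<Longrightarrow> N y \<noteq> 0 \<Longrightarrow> 2 * b - (real DIM('e) - 2) * t y \<noteq> 0 \<Longrightarrow>
        G y z (N y) = 0 \<Longrightarrow> G y z (J y (N y)) = 0 \<Longrightarrow> \<exists>l. \<forall>w. B y z w = l * G y z w"
    and x: "x \<in> S" and N: "N x \<noteq> 0" and v: "v \<noteq> 0" "G x v (N x) = 0" "G x v (J x (N x)) = 0"
  shows "eigenvector (G x) (B x) v"
proof -
  have identity: "B x (hor v x) w * G x (hor v x) (hor v x) - B x (hor v x) (hor v x) * G x (hor v x) w = 0" for w
  proof (rule zero_by_density[OF open_S x continuous_t, of _ "{0, 2 * b / (real DIM('e) - 2)}"])
    show "continuous_on S (\<lambda>y. B y (hor v y) w * G y (hor v y) (hor v y) - B y (hor v y) (hor v y) * G y (hor v y) w)"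
      by (intro continuous_intros smooth_on_continuous smooth_on_bilinear_family[OF open_S bil smooth]
          smooth_on_bilinear_family[OF open_S bilinear_G smooth_G] smooth_hor smooth_on_const)
    show "B y (hor v y) w * G y (hor v y) (hor v y) - B y (hor v y) (hor v y) * G y (hor v y) w = 0"
      if y: "y \<in> S" and "t y \<notin> {0, 2 * b / (real DIM('e) - 2)}" for y
    proof (cases "N y = 0")
      case True
      then have "hor v y = 0"
        using linear_0[OF linear_J[OF y]] linear_0[OF linear_dt[OF y]] by (simp add: hor_def)
      then show ?thesis
        by (simp add: bilinear_lzero[OF bilinear_G[OF y]] bilinear_lzero[OF bil[OF y]])
    next
      case False
      have "y \<in> U" "2 * b - (real DIM('e) - 2) * t y \<noteq> 0"
        using that dim by (auto simp: U_def field_simps)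
      from generic[OF this(1) False this(2) hor_orthogonal[OF y]]
      obtain l where "\<And>w. B y (hor v y) w = l * G y (hor v y) w" by blast
      then show ?thesis by simp
    qed
    show "B x (hor v x) w * G x (hor v x) (hor v x) - B x (hor v x) (hor v x) * G x (hor v x) w = 0"
      if T: "open T" "x \<in> T" "T \<subseteq> S" and c: "\<And>y. y \<in> T \<Longrightarrow> t y = c" for T c
    proof -
      have "dt x z = 0" for z
        using dirder_cong[OF T(1,2) c] by (simp add: frechet_derivative_const)
      then have "N x = 0"
        using G_grad_right[OF x] linear_G(1)[OF x] by (intro inner_form_eqI[OF G[OF x]]) (simp add: G_grad[OF x] G_linear[OF x])
      with N show ?thesis by simp
    qed
  qed simp
  define Q where "Q = dt x (N x)"
  have Q: "Q > 0" using G[OF x] N G_grad[OF x] unfolding Q_def inner_form_def by metis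
  have hor: "hor v x = Q *\<^sub>R v" using v by (simp add: hor_def Q_def)
  have Gv: "G x v v > 0" using G[OF x] v(1) unfolding inner_form_def by blast
  have "B x v w * G x v v = B x v v * G x v w" for w
    using identity[of w] Q
    by (simp add: hor G_linear[OF x] bilinear_lmul[OF bil[OF x]] bilinear_rmul[OF bil[OF x]])
  then have "B x v w = B x v v / G x v v * G x v w" for w
    using Gv by (simp add: field_simps)
  then show ?thesis using v(1) unfolding eigenvector_def by blast
qed

lemma hessian_eigenvector:
  assumes "x \<in> S" "N x \<noteq> 0" "v \<noteq> 0" "G x v (N x) = 0" "G x v (J x (N x)) = 0"
  shows "eigenvector (G x) (H x) v"
  by (rule eigenvector_by_density[OF bilinear_hessian smooth_hessian hessian_eigenvector_generic assms])

text \<open>At generic points the soliton equation makes an eigenvector of the Hessian one of the Ricci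
  tensor.\<close>

lemma ricci_eigenvector:
  assumes "x \<in> S" "N x \<noteq> 0" "v \<noteq> 0" "G x v (N x) = 0" "G x v (J x (N x)) = 0"
  shows "eigenvector (G x) (ricci G x) v"
proof (rule eigenvector_by_density[OF bilinear_ricci smooth_ricci _ assms])
  fix y z assume y: "y \<in> U" "N y \<noteq> 0" "2 * b - (real DIM('e) - 2) * t y \<noteq> 0"
    and z: "G y z (N y) = 0" "G y z (J y (N y)) = 0"
  obtain l where l: "\<And>w. H y z w = l * G y z w" using hessian_eigenvector_generic[OF y z] by blast
  obtain s where s: "\<And>u v. ricci G y u v + hess_coeff DIM('e) b (t y) * H y u v = s * G y u v"
    using soliton_equation[OF y(1)] by blast
  have "ricci G y z w = (s - hess_coeff DIM('e) b (t y) * l) * G y z w" for w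
    using s[of z w] by (simp add: l algebra_simps)
  then show "\<exists>l. \<forall>w. ricci G y z w = l * G y z w" by blast
qed

end

section \<open>Charts\<close>

lemma chart_facts:
  assumes "smooth_manifold A" "c \<in> A"
  shows "open (cdom c)" "open (cmap c ` cdom c)"
    "homeomorphism (cdom c) (cmap c ` cdom c) (cmap c) (cinv c)"
    "p \<in> cdom c \<Longrightarrow> cinv c (cmap c p) = p"
  using assms homeomorphism_apply1 unfolding smooth_manifold_def by blast+

lemma open_chart_image:
  assumes "smooth_manifold A" "c \<in> A" "open W" "W \<subseteq> cdom c"
  shows "open (cmap c ` W)"
proof -
  have "openin (top_of_set (cdom c)) W" using assms(3,4) by (simp add: open_subset)
  then have "openin (top_of_set (cmap c ` cdom c)) (cmap c ` W)"
    by (rule homeomorphism_imp_open_map[OF chart_facts(3)[OF assms(1,2)]])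
  then show ?thesis using openin_open_trans chart_facts(2)[OF assms(1,2)] by blast
qed

lemma transition_chain:
  fixes A :: "('m::{t2_space,second_countable_topology}, 'e::euclidean_space) chart set"
  assumes A: "smooth_manifold A" "c \<in> A" "d \<in> A" and x: "x \<in> cmap c ` (cdom c \<inter> cdom d)"
    and h: "h differentiable (at (transition c d x))"
  shows "dirder (h \<circ> transition c d) x v = dirder h (transition c d x) (dirder (transition c d) x v)"
proof -
  have "smooth_on (cmap c ` (cdom c \<inter> cdom d)) (transition c d)"
    using A unfolding smooth_manifold_def by blast
  then have "transition c d differentiable (at x)" using x by (rule smooth_on_differentiable)
  from has_derivative_compose[OF dirder_has_derivative[OF this] dirder_has_derivative[OF h]]
  show ?thesis unfolding o_def by (rule dirder_eqI)
qed

lemma overlap_facts: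
  fixes A :: "('m::{t2_space,second_countable_topology}, 'e::euclidean_space) chart set"
  assumes A: "smooth_manifold A" "c \<in> A" "d \<in> A"
  shows "open (cmap c ` (cdom c \<inter> cdom d))"
    and "x \<in> cmap c ` (cdom c \<inter> cdom d) \<Longrightarrow> transition c d x \<in> cmap d ` (cdom d \<inter> cdom c)"
    and "x \<in> cmap c ` (cdom c \<inter> cdom d) \<Longrightarrow> transition d c (transition c d x) = x"
    and "x \<in> cmap c ` (cdom c \<inter> cdom d) \<Longrightarrow> cinv d (transition c d x) = cinv c x"
    and "p \<in> cdom c \<Longrightarrow> transition c d (cmap c p) = cmap d p"
proof -
  show "open (cmap c ` (cdom c \<inter> cdom d))"
    using chart_facts(1)[OF A(1)] A by (intro open_chart_image[OF A(1,2)] open_Int) auto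
qed (auto simp: transition_def chart_facts(4)[OF A(1,2)] chart_facts(4)[OF A(1,3)])

text \<open>The transition map in the other direction is an inverse, and so is its derivative.\<close>

lemma transition_derivative_surj:
  fixes A :: "('m::{t2_space,second_countable_topology}, 'e::euclidean_space) chart set"
  assumes A: "smooth_manifold A" "c \<in> A" "d \<in> A" and x: "x \<in> cmap c ` (cdom c \<inter> cdom d)"
  obtains v where "dirder (transition c d) x v = z"
proof
  let ?y = "transition c d x"
  have y: "?y \<in> cmap d ` (cdom d \<inter> cdom c)" by (rule overlap_facts(2)[OF A x])
  have inv: "transition d c ?y = x" by (rule overlap_facts(3)[OF A x])
  have "smooth_on (cmap c ` (cdom c \<inter> cdom d)) (transition c d)"
    using A unfolding smooth_manifold_def by blast
  then have "transition c d differentiable (at x)" using x by (rule smooth_on_differentiable)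
  then have "dirder (transition c d) x (dirder (transition d c) ?y z) = dirder (transition c d \<circ> transition d c) ?y z"
    using transition_chain[OF A(1,3,2) y, of "transition c d" z] by (simp add: inv)
  also have "\<dots> = dirder (\<lambda>y. y) ?y z"
    using overlap_facts(3)[OF A(1,3,2)]
    by (intro fun_cong[OF dirder_cong[OF overlap_facts(1)[OF A(1,3,2)] y]]) simp
  finally show "dirder (transition c d) x (dirder (transition d c) ?y z) = z"
    by (simp add: frechet_derivative_ident)
qed

lemma dirder_transition_fun:
  fixes A :: "('m::{t2_space,second_countable_topology}, 'e::euclidean_space) chart set"
  assumes A: "smooth_manifold A" "c \<in> A" "d \<in> A" and f: "smooth_fun A UNIV f"
    and x: "x \<in> cmap c ` (cdom c \<inter> cdom d)"
  shows "dirder (f \<circ> cinv c) x v = dirder (f \<circ> cinv d) (transition c d x) (dirder (transition c d) x v)"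
proof -
  have "smooth_on (cmap d ` cdom d) (f \<circ> cinv d)" using f A(3) by (auto simp: smooth_fun_def)
  then have "(f \<circ> cinv d) differentiable (at (transition c d x))"
    by (rule smooth_on_differentiable) (use overlap_facts(2)[OF A x] in blast)
  from transition_chain[OF A x this, of v]
  have "dirder ((f \<circ> cinv d) \<circ> transition c d) x v = dirder (f \<circ> cinv d) (transition c d x) (dirder (transition c d) x v)" .
  moreover have "dirder (f \<circ> cinv c) x = dirder ((f \<circ> cinv d) \<circ> transition c d) x"
    using overlap_facts(4)[OF A] by (intro dirder_cong[OF overlap_facts(1)[OF A] x]) simp
  ultimately show ?thesis by simp
qed

theorem corollary3p7:
  fixes A :: "('m::{t2_space,second_countable_topology}, 'e::euclidean_space) chart set"
    and J :: "('m, 'e) endo_field"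
    and g :: "('m, 'e) bilin_field"
    and \<tau> :: "'m \<Rightarrow> real"
    and b :: real
    and m :: nat
  assumes "kaehler_manifold A J g"
    and "DIM('e) = 2 * m" and "m > 2"
    and "smooth_fun A UNIV \<tau>" and "\<exists>p q. \<tau> p \<noteq> \<tau> q"
    and "ricci_soliton A (- (\<tau> -` {0})) (conformal_metric g \<tau>) (\<lambda>p. b * inverse (\<tau> p))"
  shows "special_kaehler_ricci_potential A J g \<tau>"
proof -
  have A: "smooth_manifold A" and g: "riemannian_metric A UNIV g" and J: "endomorphism_field A UNIV J"
    using assms(1) unfolding kaehler_manifold_def by auto
  obtain e where e: "\<And>c x u v. c \<in> A \<Longrightarrow> x \<in> cmap c ` (cdom c \<inter> - (\<tau> -` {0})) \<Longrightarrow>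
     hessian (conformal_metric g \<tau> c) ((\<lambda>p. b * inverse (\<tau> p)) \<circ> cinv c) x u v
       + ricci (conformal_metric g \<tau> c) x u v = e * conformal_metric g \<tau> c x u v"
    using assms(6) unfolding ricci_soliton_def by blast
  have metric: "metric_on (cmap c ` cdom c) (g c)" if c: "c \<in> A" for c
  proof
    show "open (cmap c ` cdom c)" by (rule chart_facts(2)[OF A c])
    show "inner_form (g c x)" if "x \<in> cmap c ` cdom c" for x
      using g c that unfolding inner_form_def riemannian_metric_def bilinear_field_def by auto
    show "smooth_on (cmap c ` cdom c) (\<lambda>x. g c x u v)" for u v
      using g c unfolding riemannian_metric_def bilinear_field_def by auto
  qed
  have chart: "conformal_soliton (cmap c ` cdom c) (g c) (J c) (\<tau> \<circ> cinv c) b e" if c: "c \<in> A" for c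
  proof (intro conformal_soliton.intro conformal_soliton_axioms.intro kaehler_function.intro
      kaehler_on.intro kaehler_on_axioms.intro metric_function.intro metric_function_axioms.intro metric[OF c])
    show "linear (J c x)" if "x \<in> cmap c ` cdom c" for x
      using J c that unfolding endomorphism_field_def by auto
    show "smooth_on (cmap c ` cdom c) (\<lambda>x. J c x v)" for v
      using J c unfolding endomorphism_field_def by auto
    show "J c x (J c x v) = - v" if "x \<in> cmap c ` cdom c" for x v
      using assms(1) c that unfolding kaehler_manifold_def by auto
    show "g c x (J c x u) (J c x v) = g c x u v" if "x \<in> cmap c ` cdom c" for x u v
      using assms(1) c that unfolding kaehler_manifold_def by auto
    show "covder_endo (g c) (J c) x u v = 0" if "x \<in> cmap c ` cdom c" for x u v
      using assms(1) c that unfolding kaehler_manifold_def by auto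
    show "smooth_on (cmap c ` cdom c) (\<tau> \<circ> cinv c)"
      using assms(4) c unfolding smooth_fun_def by auto
    show "DIM('e) \<ge> 6" using assms(2,3) by simp
    show "hessian (\<lambda>x u v. g c x u v / ((\<tau> \<circ> cinv c) x)\<^sup>2) (\<lambda>y. b * inverse ((\<tau> \<circ> cinv c) y)) x u v
       + ricci (\<lambda>x u v. g c x u v / ((\<tau> \<circ> cinv c) x)\<^sup>2) x u v
       = e * (g c x u v / ((\<tau> \<circ> cinv c) x)\<^sup>2)"
      if x: "x \<in> cmap c ` cdom c" and nz: "(\<tau> \<circ> cinv c) x \<noteq> 0" for x u v
    proof -
      have "x \<in> cmap c ` (cdom c \<inter> - (\<tau> -` {0}))"
        using x nz chart_facts(4)[OF A c] by auto
      from e[OF c this, of u v] show ?thesis by (simp add: conformal_metric_def o_def)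
    qed
  qed
  have grad_transition: "dirder (transition c d) x (gradient g \<tau> c x) = gradient g \<tau> d (transition c d x)"
    if c: "c \<in> A" and d: "d \<in> A" and x: "x \<in> cmap c ` (cdom c \<inter> cdom d)" for c d x
  proof -
    interpret C: conformal_soliton "cmap c ` cdom c" "g c" "J c" "\<tau> \<circ> cinv c" b e by (rule chart[OF c])
    interpret D: conformal_soliton "cmap d ` cdom d" "g d" "J d" "\<tau> \<circ> cinv d" b e by (rule chart[OF d])
    let ?y = "transition c d x"
    have xS: "x \<in> cmap c ` cdom c" and yS: "?y \<in> cmap d ` cdom d"
      using x overlap_facts(2)[OF A c d x] by auto
    show ?thesis
    proof (rule inner_form_eqI[OF D.G[OF yS]])
      fix z
      obtain v where v: "dirder (transition c d) x v = z" by (rule transition_derivative_surj[OF A c d x])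
      have "g d ?y (dirder (transition c d) x (gradient g \<tau> c x)) z = g c x (gradient g \<tau> c x) v"
        using g c d x unfolding v[symmetric] riemannian_metric_def bilinear_field_def Int_UNIV_right by metis
      also have "\<dots> = dirder (\<tau> \<circ> cinv c) x v" by (simp add: gradient_def C.G_grad[OF xS])
      also have "\<dots> = dirder (\<tau> \<circ> cinv d) ?y z"
        by (simp add: dirder_transition_fun[OF A c d assms(4) x] v)
      also have "\<dots> = g d ?y (gradient g \<tau> d ?y) z" by (simp add: gradient_def D.G_grad[OF yS])
      finally show "g d ?y (dirder (transition c d) x (gradient g \<tau> c x)) z = g d ?y (gradient g \<tau> d ?y) z" .
    qed
  qed
  have "vector_field A UNIV (\<lambda>c x. J c x (gradient g \<tau> c x))"
    unfolding vector_field_def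
  proof (intro conjI ballI)
    fix c assume c: "c \<in> A"
    interpret C: conformal_soliton "cmap c ` cdom c" "g c" "J c" "\<tau> \<circ> cinv c" b e by (rule chart[OF c])
    show "smooth_on (cmap c ` (cdom c \<inter> UNIV)) (\<lambda>x. J c x (gradient g \<tau> c x))"
      using C.smooth_J_grad by (simp add: gradient_def)
  next
    fix c d x assume c: "c \<in> A" and d: "d \<in> A" and x: "x \<in> cmap c ` (cdom c \<inter> cdom d \<inter> UNIV)"
    then have "dirder (transition c d) x (J c x (gradient g \<tau> c x))
       = J d (transition c d x) (dirder (transition c d) x (gradient g \<tau> c x))"
      using J unfolding endomorphism_field_def by blast
    with x show "dirder (transition c d) x (J c x (gradient g \<tau> c x))
       = J d (transition c d x) (gradient g \<tau> d (transition c d x))"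
      using grad_transition[OF c d] by simp
  qed
  moreover have "lie_metric (\<lambda>x. J c x (gradient g \<tau> c x)) (g c) x u v = 0"
    if c: "c \<in> A" and x: "x \<in> cmap c ` cdom c" for c x u v
  proof -
    interpret C: conformal_soliton "cmap c ` cdom c" "g c" "J c" "\<tau> \<circ> cinv c" b e by (rule chart[OF c])
    show ?thesis unfolding gradient_def by (rule C.lie_metric_J_grad[OF x C.hessian_J_J[OF x]])
  qed
  ultimately have killing: "killing_potential A J g \<tau>"
    using assms(4) unfolding killing_potential_def killing_field_def by blast
  have "eigenvector (g c x) (hessian (g c) (\<tau> \<circ> cinv c) x) v \<and> eigenvector (g c x) (ricci (g c) x) v"
    if c: "c \<in> A" and x: "x \<in> cmap c ` (cdom c - critical_set A \<tau>)" and v: "v \<noteq> 0"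
      "g c x v (gradient g \<tau> c x) = 0" "g c x v (J c x (gradient g \<tau> c x)) = 0" for c x v
  proof -
    interpret C: conformal_soliton "cmap c ` cdom c" "g c" "J c" "\<tau> \<circ> cinv c" b e by (rule chart[OF c])
    obtain p where p: "p \<in> cdom c" "p \<notin> critical_set A \<tau>" "x = cmap c p" using x by blast
    then obtain d z where d: "d \<in> A" "p \<in> cdom d" and nz: "dirder (\<tau> \<circ> cinv d) (cmap d p) z \<noteq> 0"
      unfolding critical_set_def by blast
    have "cmap d p \<in> cmap d ` (cdom d \<inter> cdom c)" using p d by blast
    from dirder_transition_fun[OF A d(1) c assms(4) this, of z]
    have "dirder (\<tau> \<circ> cinv c) x (dirder (transition d c) (cmap d p) z) \<noteq> 0"
      using nz overlap_facts(5)[OF A d(1) c d(2)] p(3) by simp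
    moreover have xS: "x \<in> cmap c ` cdom c" using p by blast
    ultimately have "C.N x \<noteq> 0" using C.G_grad[OF xS] linear_0[OF C.linear_G(2)[OF xS]] by metis
    then show ?thesis
      using C.hessian_eigenvector[OF xS _ v(1)] C.ricci_eigenvector[OF xS _ v(1)] v(2,3)
      unfolding gradient_def by blast
  qed
  with killing assms(5) show ?thesis
    unfolding special_kaehler_ricci_potential_def by blast
qed

end
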